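(* Let $\mathfrak{g}$ be a perfect Lie algebra of finite dimension over an arbitrary field of characteristic zero and let $M$ be a $\mathfrak{g}$-module of finite dimension. Then any symmetric biderivation of $\mathfrak{g}$ with values in $M$ is trivial, i.e. identically zero.
   Context: A Lie algebra $\mathfrak{g}$ is perfect if $[\mathfrak{g},\mathfrak{g}]=\mathfrak{g}$. Let $\psi:\mathfrak{g}\to\mathfrak{gl}(M)$ be the representation defining the $\mathfrak{g}$-module $M$. A biderivation of $\mathfrak{g}$ with values in $M$ is a bilinear map $\varphi:\mathfrak{g}\times\mathfrak{g}\to M$ such that $\varphi(x,[y,z])=\psi(y)\varphi(x,z)-\psi(z)\varphi(x,y)$ and $\varphi([y,z],x)=\psi(y)\varphi(z,x)-\psi(z)\varphi(y,x)$ for all $x,y,z\in\mathfrak{g}$. It is symmetric if $\varphi(x,y)=\varphi(y,x)$ for all $x,y\in\mathfrak{g}$. *)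

theory Defs
  imports Complex_Main
begin

definition bilinear_map ::
  "('k::field \<Rightarrow> 'a::ab_group_add \<Rightarrow> 'a) \<Rightarrow> ('k \<Rightarrow> 'b::ab_group_add \<Rightarrow> 'b) \<Rightarrow>
   ('k \<Rightarrow> 'c::ab_group_add \<Rightarrow> 'c) \<Rightarrow> ('a \<Rightarrow> 'b \<Rightarrow> 'c) \<Rightarrow> bool"
  where "bilinear_map s1 s2 s3 f \<longleftrightarrow>
    (\<forall>x. Vector_Spaces.linear s2 s3 (\<lambda>y. f x y)) \<and>
    (\<forall>y. Vector_Spaces.linear s1 s3 (\<lambda>x. f x y))"

definition finite_dimensional :: "('k::field \<Rightarrow> 'a::ab_group_add \<Rightarrow> 'a) \<Rightarrow> bool"
  where "finite_dimensional s \<longleftrightarrow> (\<exists>B. finite_dimensional_vector_space s B)"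

locale lie_algebra = vector_space scale
  for scale :: "'k::field \<Rightarrow> 'g::ab_group_add \<Rightarrow> 'g" +
  fixes bracket :: "'g \<Rightarrow> 'g \<Rightarrow> 'g"
  assumes bilinear_bracket: "bilinear_map scale scale scale bracket"
    and bracket_self: "bracket x x = 0"
    and jacobi: "bracket x (bracket y z) + bracket y (bracket z x) + bracket z (bracket x y) = 0"
begin

text \<open>The derived algebra is the linear span of all brackets, not merely the set of brackets.\<close>

definition derived_algebra :: "'g set"
  where "derived_algebra = span {bracket x y | x y. True}"

definition perfect :: bool
  where "perfect \<longleftrightarrow> derived_algebra = UNIV"

end

text \<open>The representation \<open>\<psi>\<close> into \<open>gl(M)\<close> is given as a curried function: bilinearity of
  \<open>\<psi>\<close> says that each \<open>\<psi> x\<close> is an endomorphism of \<open>M\<close> and that \<open>\<psi>\<close> is linear, and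
  \<open>rep_bracket\<close> says that \<open>\<psi>\<close> takes brackets to commutators.\<close>

locale lie_module = lie_algebra scale bracket + M: vector_space scaleM
  for scale :: "'k::field \<Rightarrow> 'g::ab_group_add \<Rightarrow> 'g"
    and bracket :: "'g \<Rightarrow> 'g \<Rightarrow> 'g"
    and scaleM :: "'k \<Rightarrow> 'm::ab_group_add \<Rightarrow> 'm" +
  fixes \<psi> :: "'g \<Rightarrow> 'm \<Rightarrow> 'm"
  assumes bilinear_rep: "bilinear_map scale scaleM scaleM \<psi>"
    and rep_bracket: "\<psi> (bracket x y) v = \<psi> x (\<psi> y v) - \<psi> y (\<psi> x v)"
begin

definition biderivation :: "('g \<Rightarrow> 'g \<Rightarrow> 'm) \<Rightarrow> bool"
  where "biderivation \<phi> \<longleftrightarrow>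
    bilinear_map scale scale scaleM \<phi> \<and>
    (\<forall>x y z. \<phi> x (bracket y z) = \<psi> y (\<phi> x z) - \<psi> z (\<phi> x y)) \<and>
    (\<forall>x y z. \<phi> (bracket y z) x = \<psi> y (\<phi> z x) - \<psi> z (\<phi> y x))"

definition symmetric_biderivation :: "('g \<Rightarrow> 'g \<Rightarrow> 'm) \<Rightarrow> bool"
  where "symmetric_biderivation \<phi> \<longleftrightarrow> biderivation \<phi> \<and> (\<forall>x y. \<phi> x y = \<phi> y x)"

end

end

theory Submission
  imports Defs "Jordan_Normal_Form.Jordan_Normal_Form_Existence" "HOL-Algebra.Algebraic_Closure_Type"
begin

text \<open>
  The values of a symmetric biderivation are pushed into smaller and smaller submodules: if they lie in
  \<open>N\<close> and \<open>N'\<close> is a maximal proper submodule of \<open>N\<close>, then the biderivation induced in the irreducible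
  module \<open>N / N'\<close> is zero, so the values lie in \<open>N'\<close> (lemma \<open>symmetric_biderivation_descends\<close>). Thus
  everything rests on the case of an irreducible module \<open>W\<close> with nonzero action.

  There the trace form of \<open>W\<close> has the kernel of the representation as its radical (lemma
  \<open>trace_form_radical_eq_kernel\<close>), and it yields a Casimir operator \<open>C\<close> that commutes with the action and
  is injective on \<open>W\<close>. Comparing the two expansions of \<open>\<phi>([x,y],[u,v])\<close> shows that \<open>\<phi>\<close> vanishes if
  one argument acts by zero (lemma \<open>\<phi>_kernel\<close>), so the Lie algebra may be treated as if it acted
  faithfully. Whitehead's computation gives \<open>C \<phi>(y,z) = \<psi>(y) h(z)\<close> for a linear map \<open>h\<close> into \<open>W\<close>. The
  same computation for \<open>h\<close>, which is possible because \<open>\<psi>(y) h(z)\<close> is symmetric in \<open>y\<close> and \<open>z\<close>, gives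
  \<open>C h(z) = \<psi>(z) m\<close> for a fixed vector \<open>m\<close>. Hence \<open>C\<^sup>2 \<phi>(y,z) = \<psi>(y) \<psi>(z) m\<close>, and by symmetry of \<open>\<phi>\<close>
  all brackets annihilate \<open>m\<close>. Since the Lie algebra is perfect, it annihilates \<open>m\<close>, and therefore
  \<open>C\<^sup>2 \<phi> = 0\<close> and \<open>\<phi> = 0\<close>.

  That the radical of the trace form acts by zero is proved in two steps. By a version of Cartan's criterion
  (lemma \<open>nilpotent_of_trace_form_radical\<close>) its elements act by nilpotent operators, and by Engel's theorem
  (lemma \<open>engel_common_kernel\<close>) such an ideal annihilates a nonzero vector of \<open>W\<close>, hence all of \<open>W\<close>.
  The criterion is a statement about matrices (lemma \<open>nilpotent_of_trace_orthogonality\<close>). It is proved over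
  the algebraic closure, where a matrix has a Jordan form; characteristic zero enters because a vanishing sum
  of squares of rational numbers has only zero terms.
\<close>

section \<open>Generalized eigensequences of the shift\<close>

text \<open>Applied to \<open>\<Sum>j<n. d j * of_rat (f (d j))\<close>, the functional \<open>f\<close> gives \<open>\<Sum>j<n. (f (d j))\<^sup>2\<close>, a sum
  of squares of rational numbers. This replaces the positivity argument that is available over the
  real numbers but not over an arbitrary field of characteristic zero. A nonzero \<open>d j\<close> belongs to a
  basis over the rationals, so some \<open>f\<close> maps it to \<open>1\<close>.\<close>

lemma rational_functional_squares_zero:
  fixes d :: "nat \<Rightarrow> 'a::field_char_0"
  assumes *: "\<And>f :: 'a \<Rightarrow> rat. (\<And>x y. f (x + y) = f x + f y) \<Longrightarrow>
      (\<And>q x. f (of_rat q * x) = q * f x) \<Longrightarrow> (\<Sum>j<n. d j * of_rat (f (d j))) = 0"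
    and j: "j < n"
  shows "d j = 0"
proof (rule ccontr)
  assume nz: "d j \<noteq> 0"
  interpret V: vector_space "\<lambda>q (x::'a). of_rat q * x"
    by unfold_locales (auto simp: algebra_simps of_rat_add of_rat_mult)
  interpret Q: vector_space "\<lambda>q (x::rat). q * x"
    by unfold_locales (auto simp: algebra_simps)
  interpret P: vector_space_pair "\<lambda>q (x::'a). of_rat q * x" "\<lambda>q (x::rat). q * x" ..
  have "\<not> V.dependent {d j}" using nz by simp
  from P.linear_independent_extend[OF this, of "\<lambda>_. 1"]
  obtain f where f: "Vector_Spaces.linear (\<lambda>q (x::'a). of_rat q * x) (\<lambda>q (x::rat). q * x) f"
    and f1: "f (d j) = 1" by auto
  interpret f: Vector_Spaces.linear "\<lambda>q (x::'a). of_rat q * x" "\<lambda>q (x::rat). q * x" f by (rule f)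
  have "(\<Sum>j<n. d j * of_rat (f (d j))) = 0"
    by (rule *) (rule f.add f.scale)+
  hence "f (\<Sum>j<n. of_rat (f (d j)) * d j) = 0" by (simp add: mult.commute f.zero)
  hence "(\<Sum>j<n. (f (d j))\<^sup>2) = 0" by (simp add: f.sum f.scale power2_eq_square)
  hence "(f (d j))\<^sup>2 = 0" using j by (subst (asm) sum_nonneg_eq_0_iff) auto
  thus False using f1 by simp
qed

text \<open>The linear functional on polynomials that sends the monomial of degree \<open>i\<close> to \<open>c i\<close>. Equivalently,
  the polynomial in the shift operator is applied to \<open>c\<close> and the term of index \<open>0\<close> is taken.\<close>

definition moment_functional :: "(nat \<Rightarrow> 'a::comm_ring_1) \<Rightarrow> 'a poly \<Rightarrow> 'a" where
  "moment_functional c p = (\<Sum>i\<le>Polynomial.degree p. poly.coeff p i * c i)"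

lemma moment_functional_cong:
  "(\<And>i. c i = c' i) \<Longrightarrow> moment_functional c p = moment_functional c' p"
  by (simp add: moment_functional_def)

lemma moment_functional_altdef:
  assumes "Polynomial.degree p \<le> N"
  shows "moment_functional c p = (\<Sum>i\<le>N. poly.coeff p i * c i)"
  unfolding moment_functional_def using assms
  by (intro sum.mono_neutral_left) (auto simp: coeff_eq_0)

lemma moment_functional_add: "moment_functional c (p + q) = moment_functional c p + moment_functional c q"
proof -
  define N where "N = max (Polynomial.degree p) (Polynomial.degree q)"
  have "Polynomial.degree p \<le> N" "Polynomial.degree q \<le> N" "Polynomial.degree (p + q) \<le> N"
    by (auto simp: N_def intro: degree_add_le)
  thus ?thesis by (simp add: moment_functional_altdef sum.distrib algebra_simps)
qed

lemma moment_functional_smult: "moment_functional c (Polynomial.smult a p) = a * moment_functional c p"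
proof -
  have "Polynomial.degree (Polynomial.smult a p) \<le> Polynomial.degree p" by (rule degree_smult_le)
  thus ?thesis
    by (simp add: moment_functional_altdef[of _ "Polynomial.degree p"] sum_distrib_left mult.assoc)
qed

lemma moment_functional_pCons:
  "moment_functional c (pCons a p) = a * c 0 + moment_functional (\<lambda>i. c (Suc i)) p"
proof -
  have "Polynomial.degree (pCons a p) \<le> Suc (Polynomial.degree p)" by (rule degree_pCons_le)
  hence "moment_functional c (pCons a p) = (\<Sum>i\<le>Suc (Polynomial.degree p). poly.coeff (pCons a p) i * c i)"
    by (rule moment_functional_altdef)
  thus ?thesis by (subst (asm) sum.atMost_Suc_shift) (simp add: moment_functional_def)
qed

text \<open>A linear factor of the polynomial turns into one application of \<open>shift - a\<close> to the sequence.\<close>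

lemma moment_functional_linear_factor:
  "moment_functional c ([:- a, 1:] * p) = moment_functional (\<lambda>i. c (Suc i) - a * c i) p"
proof -
  have "moment_functional (\<lambda>i. c (Suc i) - a * c i) p
      = moment_functional (\<lambda>i. c (Suc i)) p - a * moment_functional c p"
    by (simp add: moment_functional_def algebra_simps sum_subtractf sum_distrib_left)
  moreover have "[:- a, 1:] * p = pCons 0 p + Polynomial.smult (- a) p" by simp
  ultimately show ?thesis
    by (simp only: moment_functional_add moment_functional_smult moment_functional_pCons) simp
qed

lemma moment_functional_sum:
  "moment_functional (\<lambda>i. \<Sum>\<nu>\<in>F. c \<nu> i) p = (\<Sum>\<nu>\<in>F. moment_functional (c \<nu>) p)"
  by (simp add: moment_functional_def sum_distrib_left) (rule sum.swap)

text \<open>Coprimality as a Bezout identity, the form in which it serves to single out one eigenvalue.\<close>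

definition comaximal :: "'a::comm_ring_1 \<Rightarrow> 'a \<Rightarrow> bool" where
  "comaximal p q \<longleftrightarrow> (\<exists>u v. u * p + v * q = 1)"

lemma comaximal_sym: "comaximal p q \<longleftrightarrow> comaximal q p"
  unfolding comaximal_def by (metis add.commute)

lemma comaximal_mult_left:
  assumes "comaximal p r" "comaximal q r"
  shows "comaximal (p * q) r"
proof -
  obtain u v u' v' where "u * p + v * r = 1" "u' * q + v' * r = 1"
    using assms unfolding comaximal_def by blast
  hence "(u * p + v * r) * (u' * q + v' * r) = 1" by simp
  hence "(u * u') * (p * q) + (u * p * v' + v * u' * q + v * v' * r) * r = 1"
    by (simp add: algebra_simps)
  thus ?thesis unfolding comaximal_def by blast
qed

lemma comaximal_1_left: "comaximal 1 r"
  unfolding comaximal_def by (rule exI[of _ 1], rule exI[of _ 0]) simp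

lemma comaximal_power_left: "comaximal p r \<Longrightarrow> comaximal (p ^ n) r"
  by (induction n) (auto intro: comaximal_mult_left comaximal_1_left)

lemma comaximal_prod_left: "(\<And>i. i \<in> A \<Longrightarrow> comaximal (f i) r) \<Longrightarrow> comaximal (prod f A) r"
  by (induction A rule: infinite_finite_induct) (auto intro: comaximal_mult_left comaximal_1_left)

lemma comaximal_linear_factors:
  fixes \<mu> \<nu> :: "'a::field"
  assumes "\<mu> \<noteq> \<nu>"
  shows "comaximal [:- \<mu>, 1:] [:- \<nu>, 1:]"
proof -
  have "[:1 / (\<nu> - \<mu>):] * [:- \<mu>, 1:] + [:- (1 / (\<nu> - \<mu>)):] * [:- \<nu>, 1:] = 1"
    using assms by (simp add: one_pCons flip: right_diff_distrib diff_divide_distrib)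
  thus ?thesis unfolding comaximal_def by blast
qed

text \<open>The sequence \<open>c \<mu> m\<close> arises from \<open>c \<mu> 0\<close> by applying \<open>shift - \<mu>\<close> \<open>m\<close> times, so the moment
  functional of \<open>c \<mu> 0\<close> kills the multiples of \<open>(t - \<mu>)\<^sup>M\<close>, while the sum of all these functionals
  kills the multiples of \<open>t\<close>. For \<open>\<nu> \<noteq> 0\<close> there is a multiple of \<open>t\<close> and of all \<open>(t - \<mu>)\<^sup>M\<close> with
  \<open>\<mu> \<noteq> \<nu>\<close> that is congruent to \<open>1\<close> modulo \<open>(t - \<nu>)\<^sup>M\<close>. At this polynomial the sum of the
  functionals is \<open>0\<close>, and its only contribution is \<open>c \<nu> 0 0\<close>.\<close>

lemma generalized_eigensequences_independent:
  fixes c :: "'a::field_char_0 \<Rightarrow> nat \<Rightarrow> nat \<Rightarrow> 'a"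
  assumes F: "finite F" and \<nu>: "\<nu> \<in> F" "\<nu> \<noteq> 0"
    and step: "\<And>\<mu> m r. \<mu> \<in> F \<Longrightarrow> c \<mu> (Suc m) r = c \<mu> m (Suc r) - \<mu> * c \<mu> m r"
    and vanish: "\<And>\<mu> r. \<mu> \<in> F \<Longrightarrow> c \<mu> M r = 0"
    and total: "\<And>r. r \<ge> 1 \<Longrightarrow> (\<Sum>\<mu>\<in>F. c \<mu> 0 r) = 0"
  shows "c \<nu> 0 0 = 0"
proof -
  have kill: "moment_functional (c \<mu> 0) ([:- \<mu>, 1:] ^ M * p) = 0" if "\<mu> \<in> F" for \<mu> p
  proof -
    have "moment_functional (c \<mu> 0) ([:- \<mu>, 1:] ^ m * p) = moment_functional (c \<mu> m) p" for m
    proof (induction m arbitrary: p)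
      case (Suc m)
      have "moment_functional (c \<mu> 0) ([:- \<mu>, 1:] ^ Suc m * p)
          = moment_functional (c \<mu> 0) ([:- \<mu>, 1:] ^ m * ([:- \<mu>, 1:] * p))"
        by (simp only: power_Suc2 mult.assoc)
      also have "\<dots> = moment_functional (c \<mu> (Suc m)) p"
        unfolding Suc.IH moment_functional_linear_factor
        by (rule moment_functional_cong) (simp add: step[OF that])
      finally show ?case .
    qed simp
    from this[of M] show ?thesis by (simp add: moment_functional_def vanish[OF that])
  qed
  define q where "q = [:0, 1:] * (\<Prod>\<mu>\<in>F - {\<nu>}. [:- \<mu>, 1:] ^ M)"
  have co: "comaximal [:- \<mu>, 1:] ([:- \<nu>, 1:] ^ M)" if "\<mu> \<noteq> \<nu>" for \<mu>
    using comaximal_linear_factors[OF that] comaximal_power_left comaximal_sym by blast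
  have "comaximal q ([:- \<nu>, 1:] ^ M)"
    unfolding q_def using co[of 0] \<nu>(2)
    by (intro comaximal_mult_left comaximal_prod_left comaximal_power_left co) auto
  then obtain u v where uv: "u * q + v * [:- \<nu>, 1:] ^ M = 1" unfolding comaximal_def by blast
  have "moment_functional (\<lambda>i. \<Sum>\<mu>\<in>F. c \<mu> 0 i) (u * q) = 0"
  proof -
    have "u * q = pCons 0 (u * (\<Prod>\<mu>\<in>F - {\<nu>}. [:- \<mu>, 1:] ^ M))" by (simp add: q_def)
    thus ?thesis by (simp add: moment_functional_pCons) (simp add: moment_functional_def total)
  qed
  hence "0 = (\<Sum>\<mu>\<in>F. moment_functional (c \<mu> 0) (u * q))" by (simp add: moment_functional_sum)
  also have "\<dots> = moment_functional (c \<nu> 0) (u * q) + (\<Sum>\<mu>\<in>F - {\<nu>}. moment_functional (c \<mu> 0) (u * q))"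
    by (rule sum.remove[OF F \<nu>(1)])
  also have "(\<Sum>\<mu>\<in>F - {\<nu>}. moment_functional (c \<mu> 0) (u * q)) = 0"
  proof (rule sum.neutral, rule ballI)
    fix \<mu> assume \<mu>: "\<mu> \<in> F - {\<nu>}"
    hence "(\<Prod>\<mu>\<in>F - {\<nu>}. [:- \<mu>, 1:] ^ M) = [:- \<mu>, 1:] ^ M * (\<Prod>\<mu>\<in>F - {\<nu>} - {\<mu>}. [:- \<mu>, 1:] ^ M)"
      using F by (intro prod.remove) auto
    hence "u * q = [:- \<mu>, 1:] ^ M * (u * [:0, 1:] * (\<Prod>\<mu>\<in>F - {\<nu>} - {\<mu>}. [:- \<mu>, 1:] ^ M))"
      unfolding q_def by (simp only: mult_ac)
    thus "moment_functional (c \<mu> 0) (u * q) = 0" using kill[of \<mu>] \<mu> by (simp only: Diff_iff)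
  qed
  finally have "moment_functional (c \<nu> 0) (u * q) = 0" by simp
  moreover have "moment_functional (c \<nu> 0) (v * [:- \<nu>, 1:] ^ M) = 0"
    using kill[OF \<nu>(1), of v] by (simp only: mult.commute)
  ultimately have "moment_functional (c \<nu> 0) (u * q + v * [:- \<nu>, 1:] ^ M) = 0"
    by (simp only: moment_functional_add add_0_left)
  hence "moment_functional (c \<nu> 0) 1 = 0" by (simp only: uv)
  thus ?thesis by (simp add: moment_functional_def)
qed

section \<open>Commutators with a matrix in Jordan form\<close>

lemma mult_mat_entry:
  assumes "A \<in> carrier_mat n m" "B \<in> carrier_mat m p" "i < n" "j < p"
  shows "(A * B) $$ (i, j) = (\<Sum>k\<in>{0..<m}. A $$ (i, k) * B $$ (k, j))"
  using assms by (auto simp: scalar_prod_def)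

definition mat_trace :: "'a::comm_ring_1 mat \<Rightarrow> 'a" where
  "mat_trace A = (\<Sum>i\<in>{0..<dim_row A}. A $$ (i, i))"

lemma mat_trace_mult_comm:
  assumes "A \<in> carrier_mat n m" "B \<in> carrier_mat m n"
  shows "mat_trace (A * B) = mat_trace (B * A)"
proof -
  have "mat_trace (A * B) = (\<Sum>i\<in>{0..<n}. \<Sum>k\<in>{0..<m}. A $$ (i, k) * B $$ (k, i))"
    using assms by (auto simp: mat_trace_def mult_mat_entry[OF assms] simp del: index_mult_mat(1) intro!: sum.cong)
  also have "\<dots> = (\<Sum>k\<in>{0..<m}. \<Sum>i\<in>{0..<n}. B $$ (k, i) * A $$ (i, k))"
    by (subst sum.swap) (simp add: mult.commute)
  also have "\<dots> = mat_trace (B * A)"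
    using assms by (auto simp: mat_trace_def mult_mat_entry[OF assms(2,1)] simp del: index_mult_mat(1) intro!: sum.cong)
  finally show ?thesis .
qed

lemma mat_trace_diff:
  "A \<in> carrier_mat n n \<Longrightarrow> B \<in> carrier_mat n n \<Longrightarrow> mat_trace (A - B) = mat_trace A - mat_trace B"
  by (auto simp: mat_trace_def sum_subtractf)

lemma mat_trace_smult: "A \<in> carrier_mat n n \<Longrightarrow> mat_trace (c \<cdot>\<^sub>m A) = c * mat_trace A"
  by (auto simp: mat_trace_def sum_distrib_left)

definition mat_commutator :: "'a::comm_ring_1 mat \<Rightarrow> 'a mat \<Rightarrow> 'a mat" where
  "mat_commutator A B = A * B - B * A"

lemma mat_commutator_closed [simp]:
  "A \<in> carrier_mat n n \<Longrightarrow> B \<in> carrier_mat n n \<Longrightarrow> mat_commutator A B \<in> carrier_mat n n"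
  by (auto simp: mat_commutator_def)

lemma mat_commutator_funpow_closed [simp]:
  "A \<in> carrier_mat n n \<Longrightarrow> B \<in> carrier_mat n n \<Longrightarrow> (mat_commutator A ^^ r) B \<in> carrier_mat n n"
  by (induction r) auto

lemma mat_commutator_diff_smult:
  assumes "A \<in> carrier_mat n n" "B \<in> carrier_mat n n" "C \<in> carrier_mat n n"
  shows "mat_commutator A (B - c \<cdot>\<^sub>m C) = mat_commutator A B - c \<cdot>\<^sub>m mat_commutator A C"
proof -
  have "A * (B - c \<cdot>\<^sub>m C) = A * B - c \<cdot>\<^sub>m (A * C)"
    using assms by (simp add: mult_minus_distrib_mat mult_smult_distrib)
  moreover have "(B - c \<cdot>\<^sub>m C) * A = B * A - c \<cdot>\<^sub>m (C * A)"
    using assms by (simp add: minus_mult_distrib_mat mult_smult_assoc_mat)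
  ultimately show ?thesis
    unfolding mat_commutator_def using assms by (intro eq_matI) (auto simp: algebra_simps)
qed

lemma mat_commutator_funpow_diff_smult:
  assumes "A \<in> carrier_mat n n" "B \<in> carrier_mat n n" "C \<in> carrier_mat n n"
  shows "(mat_commutator A ^^ r) (B - c \<cdot>\<^sub>m C)
      = (mat_commutator A ^^ r) B - c \<cdot>\<^sub>m (mat_commutator A ^^ r) C"
  using assms by (induction r) (auto simp: mat_commutator_diff_smult[of _ n])

lemma mat_commutator_entry:
  assumes "A \<in> carrier_mat n n" "B \<in> carrier_mat n n" "j < n" "k < n"
  shows "mat_commutator A B $$ (j, k)
    = (\<Sum>l\<in>{0..<n}. A $$ (j, l) * B $$ (l, k)) - (\<Sum>l\<in>{0..<n}. B $$ (j, l) * A $$ (l, k))"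
  using assms by (simp add: mat_commutator_def mult_mat_entry[of _ n n _ n] del: index_mult_mat(1))

text \<open>Two features of a Jordan matrix suffice: it is upper triangular, and a nonzero entry joins indices
  with the same eigenvalue. The second one says that the matrix commutes with its diagonal part.\<close>

locale jordan_like =
  fixes n :: nat and J :: "'a::field_char_0 mat"
  assumes J: "J \<in> carrier_mat n n"
    and upper: "\<And>j l. j < n \<Longrightarrow> l < n \<Longrightarrow> l < j \<Longrightarrow> J $$ (j, l) = 0"
    and block: "\<And>j l. j < n \<Longrightarrow> l < n \<Longrightarrow> J $$ (j, l) \<noteq> 0 \<Longrightarrow> J $$ (j, j) = J $$ (l, l)"
begin

abbreviation T where "T \<equiv> mat_commutator J"

definition d :: "nat \<Rightarrow> 'a" where "d j = J $$ (j, j)"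

text \<open>The eigenspace projection, for the eigenvalue \<open>\<nu>\<close>, of the commutator with the diagonal part of \<open>J\<close>.\<close>

definition component :: "'a \<Rightarrow> 'a mat \<Rightarrow> 'a mat" where
  "component \<nu> B = mat n n (\<lambda>(j, k). if d j - d k = \<nu> then B $$ (j, k) else 0)"

lemma component_closed [simp]: "component \<nu> B \<in> carrier_mat n n"
  by (simp add: component_def)

lemma component_dims [simp]: "dim_row (component \<nu> B) = n" "dim_col (component \<nu> B) = n"
  by (simp_all add: component_def)

text \<open>Multiplication by \<open>J\<close> on either side combines only entries at positions with the same eigenvalue
  difference, by the assumption on the nonzero entries of \<open>J\<close>.\<close>

lemma component_commutator:
  assumes B: "B \<in> carrier_mat n n"
  shows "component \<nu> (T B) = T (component \<nu> B)"
proof (rule eq_matI)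
  fix j k assume "j < dim_row (T (component \<nu> B))" "k < dim_col (T (component \<nu> B))"
  hence jk: "j < n" "k < n" using J by (auto simp: mat_commutator_def)
  have 1: "(\<Sum>l\<in>{0..<n}. J $$ (j, l) * component \<nu> B $$ (l, k))
      = (if d j - d k = \<nu> then \<Sum>l\<in>{0..<n}. J $$ (j, l) * B $$ (l, k) else 0)"
    (is "?L = _")
  proof -
    have "?L = (\<Sum>l\<in>{0..<n}. if d j - d k = \<nu> then J $$ (j, l) * B $$ (l, k) else 0)"
    proof (rule sum.cong[OF refl])
      fix l assume l: "l \<in> {0..<n}"
      show "J $$ (j, l) * component \<nu> B $$ (l, k)
          = (if d j - d k = \<nu> then J $$ (j, l) * B $$ (l, k) else 0)"
        using block[of j l] l jk by (cases "J $$ (j, l) = 0") (auto simp: component_def d_def)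
    qed
    thus ?thesis by simp
  qed
  have 2: "(\<Sum>l\<in>{0..<n}. component \<nu> B $$ (j, l) * J $$ (l, k))
      = (if d j - d k = \<nu> then \<Sum>l\<in>{0..<n}. B $$ (j, l) * J $$ (l, k) else 0)"
    (is "?L = _")
  proof -
    have "?L = (\<Sum>l\<in>{0..<n}. if d j - d k = \<nu> then B $$ (j, l) * J $$ (l, k) else 0)"
    proof (rule sum.cong[OF refl])
      fix l assume l: "l \<in> {0..<n}"
      show "component \<nu> B $$ (j, l) * J $$ (l, k)
          = (if d j - d k = \<nu> then B $$ (j, l) * J $$ (l, k) else 0)"
        using block[of l k] l jk by (cases "J $$ (l, k) = 0") (auto simp: component_def d_def)
    qed
    thus ?thesis by simp
  qed
  show "component \<nu> (T B) $$ (j, k) = T (component \<nu> B) $$ (j, k)"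
    using jk by (subst mat_commutator_entry[OF J component_closed])
      (simp_all add: 1 2, simp add: component_def mat_commutator_entry[OF J B])
qed (use J in \<open>auto simp: component_def mat_commutator_def\<close>)

lemma component_funpow:
  "B \<in> carrier_mat n n \<Longrightarrow> component \<nu> ((T ^^ r) B) = (T ^^ r) (component \<nu> B)"
  using J by (induction r) (auto simp: component_commutator)

text \<open>On the component for \<open>\<nu>\<close> this is the commutator with the strictly upper triangular part of \<open>J\<close>.\<close>

definition T_shift :: "'a \<Rightarrow> 'a mat \<Rightarrow> 'a mat" where
  "T_shift \<nu> B = T B - \<nu> \<cdot>\<^sub>m B"

lemma T_shift_closed [simp]: "B \<in> carrier_mat n n \<Longrightarrow> T_shift \<nu> B \<in> carrier_mat n n"
  unfolding T_shift_def by (intro minus_carrier_mat smult_carrier_mat)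

lemma T_shift_funpow_closed [simp]: "B \<in> carrier_mat n n \<Longrightarrow> (T_shift \<nu> ^^ m) B \<in> carrier_mat n n"
  by (induction m) auto

text \<open>The diagonal of \<open>J\<close> contributes \<open>d j - d k - \<nu> = 0\<close>, and every other term moves an entry strictly
  away from the lower left corner: the column index minus the row index goes up.\<close>

lemma T_shift_entry_eq_0:
  assumes B: "B \<in> carrier_mat n n" and jk: "j < n" "k < n"
    and supp: "\<And>i l. i < n \<Longrightarrow> l < n \<Longrightarrow> B $$ (i, l) \<noteq> 0 \<Longrightarrow> d i - d l = \<nu> \<and> i + m \<le> l + n"
    and small: "k + n < j + Suc m"
  shows "T_shift \<nu> B $$ (j, k) = 0"
proof -
  have 1: "(\<Sum>l\<in>{0..<n}. J $$ (j, l) * B $$ (l, k)) = J $$ (j, j) * B $$ (j, k)"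
  proof -
    have "J $$ (j, l) * B $$ (l, k) = 0" if "l \<in> {0..<n} - {j}" for l
      using that upper[of j l] supp[of l k] jk small by (cases "l < j") fastforce+
    hence "(\<Sum>l\<in>{0..<n} - {j}. J $$ (j, l) * B $$ (l, k)) = 0" by (intro sum.neutral) blast
    thus ?thesis using jk by (subst sum.remove[of _ j]) auto
  qed
  have 2: "(\<Sum>l\<in>{0..<n}. B $$ (j, l) * J $$ (l, k)) = B $$ (j, k) * J $$ (k, k)"
  proof -
    have "B $$ (j, l) * J $$ (l, k) = 0" if "l \<in> {0..<n} - {k}" for l
      using that upper[of l k] supp[of j l] jk small by (cases "k < l") fastforce+
    hence "(\<Sum>l\<in>{0..<n} - {k}. B $$ (j, l) * J $$ (l, k)) = 0" by (intro sum.neutral) blast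
    thus ?thesis using jk by (subst sum.remove[of _ k]) auto
  qed
  have "T_shift \<nu> B $$ (j, k) = (d j - d k - \<nu>) * B $$ (j, k)"
    unfolding T_shift_def using B J jk
    by (simp add: mat_commutator_entry[OF J B jk] 1 2) (simp add: d_def algebra_simps)
  also have "\<dots> = 0" using supp[OF jk] by auto
  finally show ?thesis .
qed

text \<open>The column index minus the row index starts above \<open>- n\<close>, stays below \<open>n\<close>, and rises at every step.\<close>

lemma T_shift_nilpotent_on_component:
  assumes B: "B \<in> carrier_mat n n"
  shows "(T_shift \<nu> ^^ (2 * n)) (component \<nu> B) = 0\<^sub>m n n"
proof -
  let ?C = "component \<nu> B"
  have supp: "d i - d l = \<nu> \<and> i + m \<le> l + n"
    if "i < n" "l < n" "(T_shift \<nu> ^^ m) ?C $$ (i, l) \<noteq> 0" for i l m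
    using that
  proof (induction m arbitrary: i l)
    case 0
    thus ?case by (auto simp: component_def split: if_splits)
  next
    case (Suc m)
    let ?E = "(T_shift \<nu> ^^ m) ?C"
    have Ec: "?E \<in> carrier_mat n n" by simp
    have E: "component \<nu> ?E = ?E"
      using Suc.IH carrier_matD[OF Ec] by (intro eq_matI) (auto simp: component_def[of _ ?E])
    have "T_shift \<nu> ?E = T (component \<nu> ?E) - \<nu> \<cdot>\<^sub>m component \<nu> ?E"
      by (simp only: E T_shift_def)
    also have "\<dots> = component \<nu> (T ?E) - \<nu> \<cdot>\<^sub>m component \<nu> ?E"
      by (simp add: component_commutator)
    finally have "T_shift \<nu> ?E $$ (i, l) = (component \<nu> (T ?E) - \<nu> \<cdot>\<^sub>m component \<nu> ?E) $$ (i, l)"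
      by simp
    hence "d i - d l = \<nu>" using Suc.prems by (auto simp: component_def split: if_splits)
    moreover have "i + Suc m \<le> l + n"
    proof (rule ccontr)
      assume "\<not> i + Suc m \<le> l + n"
      hence "T_shift \<nu> ?E $$ (i, l) = 0"
        using Suc.prems by (intro T_shift_entry_eq_0[where m = m] Suc.IH) auto
      thus False using Suc.prems by simp
    qed
    ultimately show ?case ..
  qed
  show ?thesis
  proof (rule eq_matI)
    fix i l assume "i < dim_row (0\<^sub>m n n :: 'a mat)" "l < dim_col (0\<^sub>m n n :: 'a mat)"
    thus "(T_shift \<nu> ^^ (2 * n)) ?C $$ (i, l) = 0\<^sub>m n n $$ (i, l)"
      using supp[of i l "2 * n"] by fastforce
  qed (use carrier_matD[OF T_shift_funpow_closed[OF component_closed]] in auto)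
qed

lemma mat_trace_mult_component_sum:
  assumes A: "A \<in> carrier_mat n n" and B: "B \<in> carrier_mat n n"
    and F: "finite F" "\<And>j k. j < n \<Longrightarrow> k < n \<Longrightarrow> d j - d k \<in> F"
  shows "(\<Sum>\<nu>\<in>F. g \<nu> * mat_trace (A * component \<nu> B))
    = (\<Sum>j\<in>{0..<n}. \<Sum>k\<in>{0..<n}. A $$ (j, k) * (g (d k - d j) * B $$ (k, j)))"
proof -
  have "mat_trace (A * component \<nu> B)
      = (\<Sum>j\<in>{0..<n}. \<Sum>k\<in>{0..<n}. if \<nu> = d k - d j then A $$ (j, k) * B $$ (k, j) else 0)" for \<nu>
  proof -
    have "mat_trace (A * component \<nu> B)
        = (\<Sum>j\<in>{0..<n}. \<Sum>k\<in>{0..<n}. A $$ (j, k) * component \<nu> B $$ (k, j))"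
      using A by (simp add: mat_trace_def mult_mat_entry[OF A component_closed] del: index_mult_mat(1))
    also have "\<dots> = (\<Sum>j\<in>{0..<n}. \<Sum>k\<in>{0..<n}. if \<nu> = d k - d j then A $$ (j, k) * B $$ (k, j) else 0)"
      by (intro sum.cong refl) (auto simp: component_def)
    finally show ?thesis .
  qed
  hence "(\<Sum>\<nu>\<in>F. g \<nu> * mat_trace (A * component \<nu> B))
     = (\<Sum>\<nu>\<in>F. \<Sum>j\<in>{0..<n}. \<Sum>k\<in>{0..<n}. if \<nu> = d k - d j then g \<nu> * (A $$ (j, k) * B $$ (k, j)) else 0)"
    by (simp add: sum_distrib_left if_distrib cong: if_cong)
  also have "\<dots> = (\<Sum>j\<in>{0..<n}. \<Sum>k\<in>{0..<n}. \<Sum>\<nu>\<in>F. if \<nu> = d k - d j then g \<nu> * (A $$ (j, k) * B $$ (k, j)) else 0)"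
    by (subst sum.swap, rule sum.cong[OF refl], rule sum.swap)
  also have "\<dots> = (\<Sum>j\<in>{0..<n}. \<Sum>k\<in>{0..<n}. A $$ (j, k) * (g (d k - d j) * B $$ (k, j)))"
    using F by (intro sum.cong refl) (simp add: sum.delta)
  finally show ?thesis .
qed

lemma mat_trace_mult_sum_component:
  assumes A: "A \<in> carrier_mat n n" and B: "B \<in> carrier_mat n n"
    and F: "finite F" "\<And>j k. j < n \<Longrightarrow> k < n \<Longrightarrow> d j - d k \<in> F"
  shows "(\<Sum>\<nu>\<in>F. mat_trace (A * component \<nu> B)) = mat_trace (A * B)"
  using mat_trace_mult_component_sum[OF assms, of "\<lambda>_. 1"] A
  by (auto simp: mat_trace_def mult_mat_entry[OF A B] simp del: index_mult_mat(1) intro!: sum.cong)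

text \<open>Let \<open>f\<close> be a rational linear functional on the field and \<open>H\<close> the diagonal matrix with entries
  \<open>f (d j)\<close>. Since \<open>f\<close> is additive, the commutator of \<open>B\<close> with \<open>H\<close> multiplies the component of \<open>B\<close>
  for \<open>\<nu>\<close> by \<open>- f \<nu>\<close>, so the trace of \<open>J * H\<close> is a combination, with coefficients \<open>- f \<nu>\<close>, of the
  numbers \<open>c \<nu> 0 0\<close> below. They vanish for \<open>\<nu> \<noteq> 0\<close> because \<open>r \<mapsto> c \<nu> 0 r\<close> are generalized
  eigensequences with sum \<open>0\<close> at all \<open>r \<ge> 1\<close>. Hence \<open>\<Sum>j<n. d j * f (d j) = 0\<close> for every \<open>f\<close>.\<close>

lemma eigenvalues_zero:
  assumes I: "finite I" and A: "\<And>i. i \<in> I \<Longrightarrow> A i \<in> carrier_mat n n"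
    and B: "\<And>i. i \<in> I \<Longrightarrow> B i \<in> carrier_mat n n"
    and tr: "\<And>H. H \<in> carrier_mat n n \<Longrightarrow>
      mat_trace (J * H) = (\<Sum>i\<in>I. mat_trace (mat_commutator (A i) (B i) * H))"
    and zero: "\<And>r. r \<ge> 1 \<Longrightarrow> (\<Sum>i\<in>I. mat_trace (A i * (T ^^ r) (B i))) = 0"
    and j: "j < n"
  shows "J $$ (j, j) = 0"
proof -
  define F where "F = (\<lambda>(j, k). d j - d k) ` ({..<n} \<times> {..<n})"
  have F: "finite F" "\<And>j k. j < n \<Longrightarrow> k < n \<Longrightarrow> d j - d k \<in> F"
    by (auto simp: F_def)
  define c where "c = (\<lambda>\<nu> m r. \<Sum>i\<in>I. mat_trace (A i * (T ^^ r) ((T_shift \<nu> ^^ m) (component \<nu> (B i)))))"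
  have c0: "c \<nu> 0 0 = 0" if "\<nu> \<in> F" "\<nu> \<noteq> 0" for \<nu>
  proof (rule generalized_eigensequences_independent[OF F(1) that, where M = "2 * n" and c = c])
    fix \<mu> m r
    show "c \<mu> (Suc m) r = c \<mu> m (Suc r) - \<mu> * c \<mu> m r"
    proof -
      have "mat_trace (A i * (T ^^ r) ((T_shift \<mu> ^^ Suc m) (component \<mu> (B i))))
          = mat_trace (A i * (T ^^ Suc r) ((T_shift \<mu> ^^ m) (component \<mu> (B i))))
            - \<mu> * mat_trace (A i * (T ^^ r) ((T_shift \<mu> ^^ m) (component \<mu> (B i))))"
 if i: "i \<in> I" for i
      proof -
        let ?L = "(T ^^ r) ((T_shift \<mu> ^^ Suc m) (component \<mu> (B i)))"
        let ?U = "(T ^^ Suc r) ((T_shift \<mu> ^^ m) (component \<mu> (B i)))"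
        let ?V = "(T ^^ r) ((T_shift \<mu> ^^ m) (component \<mu> (B i)))"
        have c: "?U \<in> carrier_mat n n" "?V \<in> carrier_mat n n"
          using J by simp_all
        have "?L = ?U - \<mu> \<cdot>\<^sub>m ?V"
          using J by (simp add: T_shift_def[of \<mu> "(T_shift \<mu> ^^ m) (component \<mu> (B i))"]
              funpow_swap1[of T] mat_commutator_funpow_diff_smult[of J n])
        hence "A i * ?L = A i * ?U - \<mu> \<cdot>\<^sub>m (A i * ?V)"
          using c A[OF i] by (simp add: mult_minus_distrib_mat mult_smult_distrib)
        thus ?thesis using c A[OF i]
          by (simp add: mat_trace_diff[of _ n] mat_trace_smult[of _ n])
      qed
      thus ?thesis by (simp add: c_def sum_subtractf sum_distrib_left)
    qed
  next
    fix \<mu> r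
    show "c \<mu> (2 * n) r = 0"
    proof -
      have "T (0\<^sub>m n n) = 0\<^sub>m n n" using J by (auto simp: mat_commutator_def)
      hence "(T ^^ r) (0\<^sub>m n n) = 0\<^sub>m n n" by (induction r) auto
      moreover have "dim_row (A i) = n" if "i \<in> I" for i using A[OF that] by simp
      ultimately show ?thesis using A B
        by (auto simp: c_def T_shift_nilpotent_on_component mat_trace_def right_mult_zero_mat[of _ n n]
            simp del: index_mult_mat(1) intro!: sum.neutral)
    qed
  next
    fix r :: nat assume r: "r \<ge> 1"
    have "(\<Sum>\<mu>\<in>F. c \<mu> 0 r) = (\<Sum>i\<in>I. \<Sum>\<mu>\<in>F. mat_trace (A i * component \<mu> ((T ^^ r) (B i))))"
      using B by (subst sum.swap) (simp add: c_def component_funpow)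
    also have "\<dots> = (\<Sum>i\<in>I. mat_trace (A i * (T ^^ r) (B i)))"
      using A B J F by (intro sum.cong refl mat_trace_mult_sum_component) auto
    finally show "(\<Sum>\<mu>\<in>F. c \<mu> 0 r) = 0" using zero[OF r] by simp
  qed
  have "d j = 0"
  proof (rule rational_functional_squares_zero[OF _ j])
    fix f :: "'a \<Rightarrow> rat"
    assume f_add: "\<And>x y. f (x + y) = f x + f y" and f_scale: "\<And>q x. f (of_rat q * x) = q * f x"
    have f0: "f 0 = 0" using f_scale[of 0 0] by simp
    have f_diff: "f (x - y) = f x - f y" for x y
      using f_add[of "x - y" y] by simp
    define H where "H = mat n n (\<lambda>(j, k). if j = k then of_rat (f (d j)) else 0 :: 'a)"
    have H: "H \<in> carrier_mat n n" by (simp add: H_def)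
    have left: "(C * H) $$ (j, k) = C $$ (j, k) * of_rat (f (d k))"
      if "C \<in> carrier_mat n n" "j < n" "k < n" for C j k
    proof -
      have "(C * H) $$ (j, k) = (\<Sum>l\<in>{0..<n}. C $$ (j, l) * H $$ (l, k))"
        by (rule mult_mat_entry[OF that(1) H that(2,3)])
      also have "\<dots> = (\<Sum>l\<in>{0..<n}. if l = k then C $$ (j, l) * of_rat (f (d l)) else 0)"
        using that by (intro sum.cong refl) (simp add: H_def)
      finally show ?thesis using that by (simp add: sum.delta)
    qed
    have right: "(H * C) $$ (j, k) = of_rat (f (d j)) * C $$ (j, k)"
      if "C \<in> carrier_mat n n" "j < n" "k < n" for C j k
    proof -
      have "(H * C) $$ (j, k) = (\<Sum>l\<in>{0..<n}. H $$ (j, l) * C $$ (l, k))"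
        by (rule mult_mat_entry[OF H that])
      also have "\<dots> = (\<Sum>l\<in>{0..<n}. if l = j then of_rat (f (d l)) * C $$ (l, k) else 0)"
        using that by (intro sum.cong refl) (simp add: H_def)
      finally show ?thesis using that by (simp add: sum.delta)
    qed
    have "mat_trace (mat_commutator (A i) (B i) * H)
        = (\<Sum>\<nu>\<in>F. - of_rat (f \<nu>) * mat_trace (A i * component \<nu> (B i)))" if i: "i \<in> I" for i
    proof -
      note Ai = A[OF i] and Bi = B[OF i]
      have "mat_trace (mat_commutator (A i) (B i) * H) = mat_trace (A i * B i * H) - mat_trace (B i * A i * H)"
        using Ai Bi H by (simp add: mat_commutator_def minus_mult_distrib_mat[of _ n n] mat_trace_diff[of _ n])
      also have "mat_trace (B i * A i * H) = mat_trace (A i * (H * B i))"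
      proof -
        have "mat_trace (B i * (A i * H)) = mat_trace (A i * H * B i)"
          using Ai Bi H by (intro mat_trace_mult_comm[of _ n n]) auto
        thus ?thesis using Ai Bi H by simp
      qed
      also have "mat_trace (A i * B i * H) - mat_trace (A i * (H * B i)) = mat_trace (A i * (B i * H - H * B i))"
      proof -
        have "A i * (B i * H - H * B i) = A i * (B i * H) - A i * (H * B i)"
          using Ai Bi H by (intro mult_minus_distrib_mat) auto
        moreover have "A i * B i * H = A i * (B i * H)" using Ai Bi H by simp
        moreover have "A i * (B i * H) \<in> carrier_mat n n" "A i * (H * B i) \<in> carrier_mat n n"
          using Ai Bi H by auto
        ultimately show ?thesis by (simp add: mat_trace_diff)
      qed
      also have "\<dots> = (\<Sum>j\<in>{0..<n}. \<Sum>k\<in>{0..<n}. A i $$ (j, k) * (- of_rat (f (d k - d j)) * B i $$ (k, j)))"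
      proof -
        have E: "B i * H - H * B i \<in> carrier_mat n n" using Bi H by auto
        have "(B i * H - H * B i) $$ (k, j) = - of_rat (f (d k - d j)) * B i $$ (k, j)"
          if "k < n" "j < n" for j k
          using that Bi H left[OF Bi that] right[OF Bi that]
          by (simp add: f_diff of_rat_diff algebra_simps del: index_mult_mat(1))
        thus ?thesis using Ai by (auto simp: mat_trace_def mult_mat_entry[OF Ai E]
            simp del: index_mult_mat(1) index_minus_mat intro!: sum.cong)
      qed
      also have "\<dots> = (\<Sum>\<nu>\<in>F. - of_rat (f \<nu>) * mat_trace (A i * component \<nu> (B i)))"
        by (rule mat_trace_mult_component_sum[OF Ai Bi F, symmetric])
      finally show ?thesis .
    qed
    hence "mat_trace (J * H) = (\<Sum>i\<in>I. \<Sum>\<nu>\<in>F. - of_rat (f \<nu>) * mat_trace (A i * component \<nu> (B i)))"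
      by (simp add: tr[OF H])
    also have "\<dots> = (\<Sum>\<nu>\<in>F. - of_rat (f \<nu>) * c \<nu> 0 0)"
      by (subst sum.swap) (simp add: c_def sum_distrib_left)
    also have "\<dots> = 0"
    proof (intro sum.neutral ballI)
      fix \<nu> assume "\<nu> \<in> F"
      thus "- of_rat (f \<nu>) * c \<nu> 0 0 = 0" using c0[of \<nu>] f0 by (cases "\<nu> = 0") auto
    qed
    finally have "mat_trace (J * H) = 0" .
    thus "(\<Sum>j<n. d j * of_rat (f (d j))) = 0"
      using J by (simp add: mat_trace_def left[OF J] d_def atLeast0LessThan del: index_mult_mat(1))
  qed
  thus ?thesis by (simp add: d_def)
qed

end

section \<open>Nilpotency from orthogonality for the trace\<close>

text \<open>If entry \<open>k\<close> of \<open>v\<close> is nonzero, then \<open>v\<close> can replace the standard basis vector number \<open>k\<close>; the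
  columns \<open>0\<close> and \<open>k\<close> are then exchanged so that \<open>v\<close> comes first.\<close>

lemma obtain_first_column_completion:
  fixes v :: "'a::field vec"
  assumes v: "v \<in> carrier_vec n" "v \<noteq> 0\<^sub>v n" and n: "n \<noteq> 0"
  obtains P Q where "P \<in> carrier_mat n n" "Q \<in> carrier_mat n n" "P * Q = 1\<^sub>m n" "Q * P = 1\<^sub>m n"
    "col P 0 = v"
proof -
  obtain k where k: "k < n" "v $ k \<noteq> 0"
    using v by (metis carrier_vecD eq_vecI index_zero_vec)
  define P where "P = mat n n (\<lambda>(i, j). if j = 0 then v $ i else if i = (if j = k then 0 else j) then 1 else 0)"
  have P: "P \<in> carrier_mat n n" by (simp add: P_def)
  have "det P \<noteq> 0"
  proof
    assume "det P = 0"
    then obtain u where u: "u \<in> carrier_vec n" "u \<noteq> 0\<^sub>v n" "P *\<^sub>v u = 0\<^sub>v n"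
      using det_0_iff_vec_prod_zero_field[OF P] by blast
    have row: "v $ i * u $ 0 + (\<Sum>j\<in>{0..<n} - {0}. P $$ (i, j) * u $ j) = 0" if i: "i < n" for i
    proof -
      have "(P *\<^sub>v u) $ i = (\<Sum>j\<in>{0..<n}. P $$ (i, j) * u $ j)"
        using i P u(1) by (auto simp: scalar_prod_def)
      also have "\<dots> = P $$ (i, 0) * u $ 0 + (\<Sum>j\<in>{0..<n} - {0}. P $$ (i, j) * u $ j)"
        using n by (intro sum.remove) auto
      finally have "v $ i * u $ 0 + (\<Sum>j\<in>{0..<n} - {0}. P $$ (i, j) * u $ j) = (P *\<^sub>v u) $ i"
        using i n by (simp add: P_def)
      thus ?thesis using i u(3) by simp
    qed
    have "(\<Sum>j\<in>{0..<n} - {0}. P $$ (k, j) * u $ j) = 0"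
      using k by (intro sum.neutral) (auto simp: P_def)
    hence u0: "u $ 0 = 0" using row[OF k(1)] k(2) by simp
    have "u $ i = 0" if i: "i < n" "i \<noteq> 0" for i
    proof -
      let ?l = "if i = k then 0 else i"
      have l: "?l < n" using i by auto
      have "(\<Sum>j\<in>{0..<n} - {0}. P $$ (?l, j) * u $ j) = (\<Sum>j\<in>{0..<n} - {0}. if j = i then u $ j else 0)"
        using l i by (intro sum.cong refl) (auto simp: P_def)
      also have "\<dots> = u $ i" using i by (simp add: sum.delta)
      finally show ?thesis using row[OF l] u0 by simp
    qed
    hence "u $ i = 0" if "i < n" for i using that u0 by (cases "i = 0") auto
    hence "u = 0\<^sub>v n" using u(1) by (intro eq_vecI) auto
    thus False using u(2) by simp
  qed
  from det_non_zero_imp_unit[OF P this, of undefined]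
  obtain Q where Q: "Q \<in> carrier_mat n n" "P * Q = 1\<^sub>m n" "Q * P = 1\<^sub>m n"
    unfolding Units_def ring_mat_def by auto
  have "col P 0 = v" using n v(1) by (intro eq_vecI) (auto simp: P_def)
  thus thesis using that P Q by blast
qed

text \<open>An eigenvector as first basis vector splits off a block of size one.\<close>

lemma triangularizable_alg_closed:
  fixes A :: "'a::alg_closed_field mat"
  assumes "A \<in> carrier_mat n n"
  shows "\<exists>B. B \<in> carrier_mat n n \<and> upper_triangular B \<and> similar_mat A B"
  using assms
proof (induction n arbitrary: A)
  case 0
  hence "upper_triangular A" by auto
  thus ?case using 0 similar_mat_refl by blast
next
  case (Suc n)
  note A = Suc.prems
  have "Polynomial.degree (char_poly A) > 0" using degree_monic_char_poly[OF A] by simp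
  then obtain e where "poly (char_poly A) e = 0" using alg_closed_imp_poly_has_root by blast
  hence "eigenvalue A e" using eigenvalue_root_char_poly[OF A] by simp
  then obtain v where v: "v \<in> carrier_vec (Suc n)" "v \<noteq> 0\<^sub>v (Suc n)" and Av: "A *\<^sub>v v = e \<cdot>\<^sub>v v"
    using A by (auto simp: eigenvalue_def eigenvector_def)
  obtain P Q where P: "P \<in> carrier_mat (Suc n) (Suc n)" and Q: "Q \<in> carrier_mat (Suc n) (Suc n)"
    and PQ: "P * Q = 1\<^sub>m (Suc n)" "Q * P = 1\<^sub>m (Suc n)" and col: "col P 0 = v"
    using obtain_first_column_completion[OF v] by blast
  define A' where "A' = Q * (A * P)"
  have A': "A' \<in> carrier_mat (Suc n) (Suc n)" using A P Q by (simp add: A'_def)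
  have "P * A' * Q = A"
  proof -
    have "P * A' * Q = (P * Q) * A * (P * Q)"
      using A P Q by (simp add: A'_def assoc_mult_mat[of _ "Suc n" "Suc n" _ "Suc n" _ "Suc n"])
    thus ?thesis using A by (simp add: PQ)
  qed
  hence sim: "similar_mat A A'"
    unfolding similar_mat_def using similar_mat_witI[OF PQ _ A A' P Q] by metis
  have "col A' 0 = e \<cdot>\<^sub>v unit_vec (Suc n) 0"
  proof -
    have "col A' 0 = Q *\<^sub>v (A *\<^sub>v v)"
      using col unfolding A'_def
      by (subst col_mult2[OF Q mult_carrier_mat[OF A P]], simp, subst col_mult2[OF A P], auto)
    also have "\<dots> = e \<cdot>\<^sub>v (Q *\<^sub>v v)" using Q v by (simp add: Av mult_mat_vec)
    also have "Q *\<^sub>v v = col (Q * P) 0"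
      using col by (subst col_mult2[OF Q P]) auto
    also have "\<dots> = unit_vec (Suc n) 0" by (simp add: PQ)
    finally show ?thesis .
  qed
  hence col0: "A' $$ (i, 0) = (if i = 0 then e else 0)" if "i < Suc n" for i
    using that A' by (metis (no_types, lifting) carrier_matD index_col index_smult_vec(1) index_unit_vec(1,3)
        mult.right_neutral mult_zero_right zero_less_Suc)
  obtain A1 A2 A3 A4 where spl: "split_block A' 1 1 = (A1, A2, A3, A4)" by (cases "split_block A' 1 1") auto
  have dims: "dim_row A' = 1 + n" "dim_col A' = 1 + n" using A' by auto
  note sb = split_block[OF spl dims]
  have A3: "A3 = 0\<^sub>m n 1"
  proof (rule eq_matI)
    fix i j assume "i < dim_row (0\<^sub>m n 1 :: 'a mat)" "j < dim_col (0\<^sub>m n 1 :: 'a mat)"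
    hence ij: "i < n" "j = 0" by auto
    have "A' $$ (Suc i, 0) = A3 $$ (i, j)"
      using ij sb(1-4) by (subst sb(5)) auto
    thus "A3 $$ (i, j) = 0\<^sub>m n 1 $$ (i, j)" using ij col0[of "Suc i"] by simp
  qed (use sb(3) in auto)
  obtain B4 where B4: "B4 \<in> carrier_mat n n" "upper_triangular B4" "similar_mat A4 B4"
    using Suc.IH[OF sb(4)] by blast
  from similar_mat_four_block_0_ex[OF similar_mat_refl[OF sb(1)] B4(3) sb(2) sb(1) sb(4)]
  obtain B2 where B2: "B2 \<in> carrier_mat 1 n"
    and sim2: "similar_mat (four_block_mat A1 A2 (0\<^sub>m n 1) A4) (four_block_mat A1 B2 (0\<^sub>m n 1) B4)"
    by blast
  let ?B = "four_block_mat A1 B2 (0\<^sub>m n 1) B4"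
  have "?B \<in> carrier_mat (Suc n) (Suc n)"
    using four_block_carrier_mat[OF sb(1) B4(1)] by simp
  moreover have "upper_triangular ?B"
    using sb(1) B4 by (auto simp: upper_triangular_def)
  moreover have "similar_mat A ?B"
    using similar_mat_trans[OF sim] sim2 sb(5) A3 by simp
  ultimately show ?case by blast
qed

lemma jordan_like_jordan_matrix:
  fixes n_as :: "(nat \<times> 'a::field_char_0) list"
  shows "jordan_like (sum_list (map fst n_as)) (jordan_matrix n_as)"
proof (induction n_as)
  case Nil
  show ?case by unfold_locales (auto simp: jordan_matrix_def)
next
  case (Cons na n_as)
  obtain m a where na: "na = (m, a)" by force
  let ?N = "sum_list (map fst n_as)"
  interpret jordan_like ?N "jordan_matrix n_as" by (rule Cons.IH)
  show ?case
  proof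
    show "jordan_matrix (na # n_as)
        \<in> carrier_mat (sum_list (map fst (na # n_as))) (sum_list (map fst (na # n_as)))"
      by (rule carrier_matI) auto
  next
    fix j l assume jl: "j < sum_list (map fst (na # n_as))" "l < sum_list (map fst (na # n_as))" "l < j"
    thus "jordan_matrix (na # n_as) $$ (j, l) = 0"
      using upper[of "j - m" "l - m"] by (auto simp: na jordan_matrix_Cons)
  next
    fix j l assume jl: "j < sum_list (map fst (na # n_as))" "l < sum_list (map fst (na # n_as))"
      "jordan_matrix (na # n_as) $$ (j, l) \<noteq> 0"
    thus "jordan_matrix (na # n_as) $$ (j, j) = jordan_matrix (na # n_as) $$ (l, l)"
      using block[of "j - m" "l - m"] by (auto simp: na jordan_matrix_Cons split: if_splits)
  qed
qed

lemma strictly_upper_triangular_nilpotent: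
  fixes J :: "'a::semiring_1 mat"
  assumes J: "J \<in> carrier_mat n n"
    and upper: "\<And>j l. j < n \<Longrightarrow> l < n \<Longrightarrow> l \<le> j \<Longrightarrow> J $$ (j, l) = 0"
  shows "J ^\<^sub>m n = 0\<^sub>m n n"
proof -
  have 1: "(J ^\<^sub>m m) $$ (j, l) = 0" if "j < n" "l < n" "l < j + m" for m j l
    using that
  proof (induction m arbitrary: l)
    case 0
    thus ?case using J by simp
  next
    case (Suc m)
    have "(J ^\<^sub>m Suc m) $$ (j, l) = (\<Sum>k\<in>{0..<n}. (J ^\<^sub>m m) $$ (j, k) * J $$ (k, l))"
      using Suc.prems J by (auto simp: scalar_prod_def)
    also have "\<dots> = 0"
    proof (intro sum.neutral ballI)
      fix k assume k: "k \<in> {0..<n}"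
      show "(J ^\<^sub>m m) $$ (j, k) * J $$ (k, l) = 0"
        using Suc.IH[of k] upper[of k l] Suc.prems k by (cases "l \<le> k") auto
    qed
    finally show ?case .
  qed
  show ?thesis
    using J by (intro eq_matI) (auto simp: 1)
qed

text \<open>Hypotheses and conclusion are invariant under simultaneous conjugation of \<open>Y\<close>, \<open>A i\<close> and \<open>B i\<close>,
  so \<open>Y\<close> may be replaced by its Jordan form, whose diagonal then vanishes.\<close>

lemma nilpotent_of_trace_orthogonality_alg_closed:
  fixes Y :: "'a::{alg_closed_field, field_char_0} mat"
  assumes Y: "Y \<in> carrier_mat n n" and I: "finite I"
    and A: "\<And>i. i \<in> I \<Longrightarrow> A i \<in> carrier_mat n n"
    and B: "\<And>i. i \<in> I \<Longrightarrow> B i \<in> carrier_mat n n"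
    and Y_eq: "\<And>j k. j < n \<Longrightarrow> k < n \<Longrightarrow> Y $$ (j, k) = (\<Sum>i\<in>I. mat_commutator (A i) (B i) $$ (j, k))"
    and zero: "\<And>r. r \<ge> 1 \<Longrightarrow> (\<Sum>i\<in>I. mat_trace (A i * (mat_commutator Y ^^ r) (B i))) = 0"
  shows "Y ^\<^sub>m n = 0\<^sub>m n n"
proof -
  obtain U where U: "U \<in> carrier_mat n n" "upper_triangular U" "similar_mat Y U"
    using triangularizable_alg_closed[OF Y] by blast
  obtain n_as where "similar_mat U (jordan_matrix n_as)"
    using triangular_to_jnf_vector[OF U(1,2)] by (auto simp: jordan_nf_def)
  hence "similar_mat Y (jordan_matrix n_as)" by (rule similar_mat_trans[OF U(3)])
  then obtain P Q where w: "similar_mat_wit Y (jordan_matrix n_as) P Q" by (auto simp: similar_mat_def)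
  define J where "J = jordan_matrix n_as"
  note wit = similar_mat_witD2[OF Y w, folded J_def]
  note [simp] = wit(4-7) mult_carrier_mat[of _ n n _ n]
  have J_eq: "J = Q * Y * P"
    using similar_mat_witD2(3)[OF wit(5) similar_mat_wit_sym[OF w, folded J_def]] by simp
  note assoc = assoc_mult_mat[of _ n n _ n _ n]
  have cancel: "P * (Q * C) = C" "Q * (P * C) = C" if "C \<in> carrier_mat n n" for C
    using that by (simp_all add: assoc[symmetric] wit(1,2) del: assoc_mult_mat)
  have "jordan_like n J"
    using jordan_like_jordan_matrix[of n_as] wit(5) unfolding J_def by (metis carrier_matD(1) jordan_matrix_dim(1))
  then interpret jordan_like n J .
  define A' where "A' = (\<lambda>i. Q * A i * P)"
  define B' where "B' = (\<lambda>i. Q * B i * P)"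
  have conj_comm: "mat_commutator (Q * C * P) (Q * D * P) = Q * mat_commutator C D * P"
    if "C \<in> carrier_mat n n" "D \<in> carrier_mat n n" for C D
  proof -
    have "Q * mat_commutator C D * P = Q * (C * D) * P - Q * (D * C) * P"
      unfolding mat_commutator_def using that
      by (subst mult_minus_distrib_mat[of _ n n _ n], (simp; fail)+)
        (rule minus_mult_distrib_mat[of _ n n _ _ n], simp_all)
    thus ?thesis using that by (simp add: mat_commutator_def assoc cancel)
  qed
  have conj_funpow: "(T ^^ r) (Q * C * P) = Q * (mat_commutator Y ^^ r) C * P"
    if "C \<in> carrier_mat n n" for C r
    using that by (induction r) (simp_all only: funpow.simps id_apply o_apply J_eq conj_comm
        mat_commutator_funpow_closed Y)
  have conj_trace: "mat_trace (Q * C * P * D) = mat_trace (C * (P * D * Q))"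
    if "C \<in> carrier_mat n n" "D \<in> carrier_mat n n" for C D
  proof -
    have "mat_trace (Q * (C * P * D)) = mat_trace (C * P * D * Q)"
      using that by (intro mat_trace_mult_comm[of _ n n]) auto
    thus ?thesis using that by (simp add: assoc)
  qed
  have diag: "J $$ (j, j) = 0" if j: "j < n" for j
  proof (rule eigenvalues_zero[OF I _ _ _ _ j, of A' B'])
    fix H :: "'a mat" assume H: "H \<in> carrier_mat n n"
    let ?H = "P * H * Q"
    have H': "?H \<in> carrier_mat n n" using H by simp
    have tr_entries: "mat_trace (C * ?H) = (\<Sum>j\<in>{0..<n}. \<Sum>k\<in>{0..<n}. C $$ (j, k) * ?H $$ (k, j))"
      if C: "C \<in> carrier_mat n n" for C
    proof -
      have "dim_row (C * ?H) = n" using C by simp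
      thus ?thesis unfolding mat_trace_def by (simp only: mult_mat_entry[OF C H'] cong: sum.cong)
        (intro sum.cong refl mult_mat_entry[OF C H'], auto)
    qed
    have "mat_trace (J * H) = mat_trace (Y * ?H)"
      unfolding J_eq by (rule conj_trace[OF Y H])
    also have "\<dots> = (\<Sum>j\<in>{0..<n}. \<Sum>k\<in>{0..<n}. \<Sum>i\<in>I. mat_commutator (A i) (B i) $$ (j, k) * ?H $$ (k, j))"
      unfolding tr_entries[OF Y] by (intro sum.cong refl) (simp add: Y_eq sum_distrib_right del: index_mult_mat(1))
    also have "\<dots> = (\<Sum>j\<in>{0..<n}. \<Sum>i\<in>I. \<Sum>k\<in>{0..<n}. mat_commutator (A i) (B i) $$ (j, k) * ?H $$ (k, j))"
      by (intro sum.cong refl sum.swap)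
    also have "\<dots> = (\<Sum>i\<in>I. \<Sum>j\<in>{0..<n}. \<Sum>k\<in>{0..<n}. mat_commutator (A i) (B i) $$ (j, k) * ?H $$ (k, j))"
      by (rule sum.swap)
    also have "\<dots> = (\<Sum>i\<in>I. mat_trace (mat_commutator (A i) (B i) * ?H))"
      using A B by (intro sum.cong refl tr_entries[symmetric]) auto
    also have "\<dots> = (\<Sum>i\<in>I. mat_trace (mat_commutator (A' i) (B' i) * H))"
      using A B H by (intro sum.cong refl) (simp only: A'_def B'_def conj_comm conj_trace mat_commutator_closed)
    finally show "mat_trace (J * H) = (\<Sum>i\<in>I. mat_trace (mat_commutator (A' i) (B' i) * H))" .
  next
    fix r :: nat assume r: "r \<ge> 1"
    have "mat_trace (A' i * (T ^^ r) (B' i)) = mat_trace (A i * (mat_commutator Y ^^ r) (B i))"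
      if i: "i \<in> I" for i
    proof -
      have c: "(mat_commutator Y ^^ r) (B i) \<in> carrier_mat n n" using B[OF i] by simp
      have "mat_trace (A' i * (T ^^ r) (B' i))
          = mat_trace (A i * (P * (Q * (mat_commutator Y ^^ r) (B i) * P) * Q))"
        unfolding A'_def B'_def conj_funpow[OF B[OF i]] using A[OF i] c by (intro conj_trace) auto
      thus ?thesis using c by (simp add: assoc cancel wit(1))
    qed
    thus "(\<Sum>i\<in>I. mat_trace (A' i * (T ^^ r) (B' i))) = 0" using zero[OF r] by simp
  qed (use A B in \<open>auto simp: A'_def B'_def\<close>)
  have "J ^\<^sub>m n = 0\<^sub>m n n"
    using diag upper J by (intro strictly_upper_triangular_nilpotent) (auto simp: le_less)
  moreover have "Y ^\<^sub>m n = P * J ^\<^sub>m n * Q"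
    using similar_mat_witD2(3)[OF _ similar_mat_wit_pow[OF w, folded J_def]] by (metis Y pow_carrier_mat)
  ultimately show ?thesis by (simp add: right_mult_zero_mat[of _ n n] left_mult_zero_mat[of _ n n])
qed

text \<open>The linear algebra behind Cartan's criterion. Hypotheses and conclusion are polynomial identities
  in the entries of the matrices, so they can be transferred to the algebraic closure.\<close>

lemma nilpotent_of_trace_orthogonality:
  fixes Y :: "'a::field_char_0 mat"
  assumes Y: "Y \<in> carrier_mat n n" and I: "finite I"
    and A: "\<And>i. i \<in> I \<Longrightarrow> A i \<in> carrier_mat n n"
    and B: "\<And>i. i \<in> I \<Longrightarrow> B i \<in> carrier_mat n n"
    and Y_eq: "\<And>j k. j < n \<Longrightarrow> k < n \<Longrightarrow> Y $$ (j, k) = (\<Sum>i\<in>I. mat_commutator (A i) (B i) $$ (j, k))"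
    and zero: "\<And>r. r \<ge> 1 \<Longrightarrow> (\<Sum>i\<in>I. mat_trace (A i * (mat_commutator Y ^^ r) (B i))) = 0"
  shows "Y ^\<^sub>m n = 0\<^sub>m n n"
proof -
  let ?h = "to_ac :: 'a \<Rightarrow> 'a alg_closure"
  interpret h: semiring_hom ?h by unfold_locales auto
  let ?m = "map_mat ?h"
  have m_comm: "?m (mat_commutator C D) = mat_commutator (?m C) (?m D)"
    if "C \<in> carrier_mat n n" "D \<in> carrier_mat n n" for C D
  proof -
    have "?m (C * D - D * C) = ?m (C * D) - ?m (D * C)" using that by (intro eq_matI) auto
    thus ?thesis using that by (simp add: mat_commutator_def h.mat_hom_mult[of _ n n])
  qed
  have m_funpow: "?m ((mat_commutator Y ^^ r) C) = (mat_commutator (?m Y) ^^ r) (?m C)"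
    if "C \<in> carrier_mat n n" for C r
    using that Y by (induction r) (auto simp: m_comm)
  have m_trace: "mat_trace (?m C) = ?h (mat_trace C)" if "C \<in> carrier_mat n n" for C
    using that by (simp add: mat_trace_def to_ac_sum)
  have "?m Y ^\<^sub>m n = 0\<^sub>m n n"
  proof (rule nilpotent_of_trace_orthogonality_alg_closed[OF _ I, of _ _ "\<lambda>i. ?m (A i)" "\<lambda>i. ?m (B i)"])
    fix j k assume jk: "j < n" "k < n"
    have "?m Y $$ (j, k) = ?h (\<Sum>i\<in>I. mat_commutator (A i) (B i) $$ (j, k))"
      using jk Y by (simp add: Y_eq)
    also have "\<dots> = (\<Sum>i\<in>I. ?m (mat_commutator (A i) (B i)) $$ (j, k))"
      unfolding to_ac_sum
    proof (rule sum.cong[OF refl])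
      fix i assume "i \<in> I"
      hence "mat_commutator (A i) (B i) \<in> carrier_mat n n" using A B by simp
      thus "?h (mat_commutator (A i) (B i) $$ (j, k)) = ?m (mat_commutator (A i) (B i)) $$ (j, k)"
        using jk by simp
    qed
    also have "\<dots> = (\<Sum>i\<in>I. mat_commutator (?m (A i)) (?m (B i)) $$ (j, k))"
      using A B by (intro sum.cong refl) (simp add: m_comm)
    finally show "?m Y $$ (j, k) = (\<Sum>i\<in>I. mat_commutator (?m (A i)) (?m (B i)) $$ (j, k))" .
  next
    fix r :: nat assume r: "r \<ge> 1"
    have "mat_trace (?m (A i) * (mat_commutator (?m Y) ^^ r) (?m (B i)))
        = ?h (mat_trace (A i * (mat_commutator Y ^^ r) (B i)))" if i: "i \<in> I" for i
    proof -
      have c: "(mat_commutator Y ^^ r) (B i) \<in> carrier_mat n n" using Y B[OF i] by simp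
      have "?m (A i) * (mat_commutator (?m Y) ^^ r) (?m (B i)) = ?m (A i * (mat_commutator Y ^^ r) (B i))"
        by (simp add: h.mat_hom_mult[OF A[OF i] c] m_funpow[OF B[OF i]])
      thus ?thesis using A[OF i] c by (simp add: m_trace)
    qed
    thus "(\<Sum>i\<in>I. mat_trace (?m (A i) * (mat_commutator (?m Y) ^^ r) (?m (B i)))) = 0"
      using zero[OF r] by (simp flip: to_ac_sum)
  qed (use Y A B in auto)
  hence eq: "?m (Y ^\<^sub>m n) = 0\<^sub>m n n" using h.mat_hom_pow[OF Y, of n] by simp
  show ?thesis
  proof (rule eq_matI)
    fix j k assume "j < dim_row (0\<^sub>m n n :: 'a mat)" "k < dim_col (0\<^sub>m n n :: 'a mat)"
    hence jk: "j < n" "k < n" by auto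
    have "?m (Y ^\<^sub>m n) $$ (j, k) = 0" using eq jk by simp
    moreover have "dim_row (Y ^\<^sub>m n) = n" "dim_col (Y ^\<^sub>m n) = n"
      using pow_carrier_mat[OF Y, of n] by auto
    ultimately show "(Y ^\<^sub>m n) $$ (j, k) = 0\<^sub>m n n $$ (j, k)" using jk by simp
  qed (use Y in auto)
qed

section \<open>Coordinates and traces of endomorphisms\<close>

context finite_dimensional_vector_space
begin

definition basis_list :: "'b list" where
  "basis_list = (SOME bs. set bs = Basis \<and> distinct bs)"

lemma basis_list: "set basis_list = Basis" "distinct basis_list" "length basis_list = dimension"
proof -
  have "\<exists>bs. set bs = Basis \<and> distinct bs" using finite_distinct_list[OF finite_Basis] by blast
  hence *: "set basis_list = Basis \<and> distinct basis_list"
    unfolding basis_list_def by (rule someI_ex)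
  thus "set basis_list = Basis" "distinct basis_list" by auto
  thus "length basis_list = dimension"
    by (metis distinct_card dimension_def)
qed

lemma sum_basis_list: "(\<Sum>b\<in>Basis. f b) = (\<Sum>i\<in>{0..<dimension}. f (basis_list ! i))"
proof -
  have "(\<Sum>b\<in>Basis. f b) = sum_list (map f basis_list)"
    using basis_list by (metis sum_list_distinct_conv_sum_set)
  thus ?thesis by (simp add: sum_list_sum_nth basis_list)
qed

lemma basis_list_nth [simp]: "i < dimension \<Longrightarrow> basis_list ! i \<in> Basis"
  using basis_list by (metis nth_mem)

definition coordinate :: "'b \<Rightarrow> nat \<Rightarrow> 'a" where
  "coordinate v i = representation Basis v (basis_list ! i)"

lemma coordinate_linear: 
  "coordinate (u + v) i = coordinate u i + coordinate v i"
  "coordinate (u - v) i = coordinate u i - coordinate v i"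
  "coordinate (scale c v) i = c * coordinate v i"
  "coordinate (sum f A) i = (\<Sum>a\<in>A. coordinate (f a) i)"
  by (simp_all add: coordinate_def representation_add representation_diff representation_scale
      representation_sum independent_Basis span_Basis)

lemma coordinate_expansion: "v = (\<Sum>i\<in>{0..<dimension}. scale (coordinate v i) (basis_list ! i))"
proof -
  have "v = (\<Sum>b\<in>Basis. scale (representation Basis v b) b)"
    using sum_representation_eq[of Basis v Basis] independent_Basis span_Basis finite_Basis by simp
  thus ?thesis unfolding coordinate_def by (subst (asm) sum_basis_list)
qed

definition to_mat :: "('b \<Rightarrow> 'b) \<Rightarrow> 'a mat" where
  "to_mat f = mat dimension dimension (\<lambda>(i, j). coordinate (f (basis_list ! j)) i)"

lemma to_mat_closed [simp]: "to_mat f \<in> carrier_mat dimension dimension"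
  by (simp add: to_mat_def)

lemma to_mat_comp:
  assumes f: "Vector_Spaces.linear scale scale f"
  shows "to_mat (\<lambda>v. f (g v)) = to_mat f * to_mat g"
proof (rule eq_matI)
  interpret f: Vector_Spaces.linear scale scale f by (rule f)
  fix i j assume "i < dim_row (to_mat f * to_mat g)" "j < dim_col (to_mat f * to_mat g)"
  hence ij: "i < dimension" "j < dimension" by (auto simp: to_mat_def)
  let ?v = "g (basis_list ! j)"
  have "f ?v = (\<Sum>k\<in>{0..<dimension}. scale (coordinate ?v k) (f (basis_list ! k)))"
    by (subst (1) coordinate_expansion) (simp add: f.sum f.scale)
  hence "to_mat (\<lambda>v. f (g v)) $$ (i, j)
      = (\<Sum>k\<in>{0..<dimension}. coordinate (f (basis_list ! k)) i * coordinate ?v k)"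
    using ij by (simp add: to_mat_def coordinate_linear mult.commute)
  also have "\<dots> = (to_mat f * to_mat g) $$ (i, j)"
    unfolding mult_mat_entry[OF to_mat_closed to_mat_closed ij]
    using ij by (intro sum.cong refl) (simp add: to_mat_def)
  finally show "to_mat (\<lambda>v. f (g v)) $$ (i, j) = (to_mat f * to_mat g) $$ (i, j)" .
qed (auto simp: to_mat_def)

lemma to_mat_diff: "to_mat (\<lambda>v. f v - g v) = to_mat f - to_mat g"
  by (rule eq_matI) (auto simp: to_mat_def coordinate_linear)

lemma to_mat_eq_0D:
  assumes f: "Vector_Spaces.linear scale scale f" and 0: "to_mat f = 0\<^sub>m dimension dimension"
  shows "f v = 0"
proof -
  interpret f: Vector_Spaces.linear scale scale f by (rule f)
  have "coordinate (f (basis_list ! j)) i = 0" if "i < dimension" "j < dimension" for i j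
  proof -
    have "to_mat f $$ (i, j) = 0" using 0 that by simp
    thus ?thesis using that by (simp add: to_mat_def)
  qed
  hence "f (basis_list ! j) = 0" if "j < dimension" for j
    using that by (subst coordinate_expansion) simp
  thus ?thesis by (subst coordinate_expansion[of v]) (simp add: f.sum f.scale)
qed

lemma to_mat_funpow:
  assumes f: "Vector_Spaces.linear scale scale f"
  shows "to_mat (f ^^ m) = to_mat f ^\<^sub>m m \<and> Vector_Spaces.linear scale scale (f ^^ m)"
proof (induction m)
  case 0
  have "to_mat (\<lambda>v. v) = 1\<^sub>m dimension"
  proof (rule eq_matI)
    fix i j assume "i < dim_row (1\<^sub>m dimension :: 'a mat)" "j < dim_col (1\<^sub>m dimension :: 'a mat)"
    hence ij: "i < dimension" "j < dimension" by auto
    thus "to_mat (\<lambda>v. v) $$ (i, j) = 1\<^sub>m dimension $$ (i, j)"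
      using basis_list nth_eq_iff_index_eq[of basis_list i j]
      by (simp add: to_mat_def coordinate_def representation_basis independent_Basis)
  qed (auto simp: to_mat_def)
  moreover have "dim_row (to_mat f) = dimension" by (simp add: to_mat_def)
  ultimately show ?case using linear_id by (simp add: id_def)
next
  case (Suc m)
  have "to_mat (f ^^ Suc m) = to_mat (\<lambda>v. (f ^^ m) (f v))" by (simp add: funpow_Suc_right o_def del: funpow.simps)
  also have "\<dots> = to_mat f ^\<^sub>m m * to_mat f" using Suc by (simp add: to_mat_comp)
  finally show ?case using Vector_Spaces.linear_compose[OF conjunct2[OF Suc] f]
    by (simp only: funpow.simps(2) pow_mat.simps(2) simp_thms)
qed

definition trace :: "('b \<Rightarrow> 'b) \<Rightarrow> 'a" where
  "trace f = mat_trace (to_mat f)"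

lemma trace_comp_comm:
  assumes "Vector_Spaces.linear scale scale f" "Vector_Spaces.linear scale scale g"
  shows "trace (\<lambda>v. f (g v)) = trace (\<lambda>v. g (f v))"
  using mat_trace_mult_comm[OF to_mat_closed to_mat_closed, of f g]
  by (simp only: trace_def to_mat_comp[OF assms(1), of g] to_mat_comp[OF assms(2), of f])

lemma trace_altdef: "trace f = (\<Sum>i\<in>{0..<dimension}. coordinate (f (basis_list ! i)) i)"
  by (simp add: trace_def mat_trace_def to_mat_def)

lemma trace_linear:
  "trace (\<lambda>v. f v + g v) = trace f + trace g"
  "trace (\<lambda>v. f v - g v) = trace f - trace g"
  "trace (\<lambda>v. scale c (f v)) = c * trace f"
  "trace (\<lambda>v. \<Sum>a\<in>A. h a v) = (\<Sum>a\<in>A. trace (h a))"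
  by (simp_all add: trace_altdef coordinate_linear sum.distrib sum_subtractf sum_distrib_left)
     (rule sum.swap)

end

section \<open>Lie algebras and their modules\<close>

context lie_algebra
begin

lemma bracket_linear:
  "bracket (x + y) z = bracket x z + bracket y z"
  "bracket z (x + y) = bracket z x + bracket z y"
  "bracket (scale c x) z = scale c (bracket x z)"
  "bracket z (scale c x) = scale c (bracket z x)"
  "bracket (x - y) z = bracket x z - bracket y z"
  "bracket z (x - y) = bracket z x - bracket z y"
  "bracket 0 z = 0" "bracket z 0 = 0"
  "bracket (- x) z = - bracket x z"
  "bracket z (- x) = - bracket z x"
  "bracket (sum f A) z = (\<Sum>a\<in>A. bracket (f a) z)"
  "bracket z (sum f A) = (\<Sum>a\<in>A. bracket z (f a))"
proof -
  interpret L: Vector_Spaces.linear scale scale "\<lambda>x. bracket x z"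
    using bilinear_bracket by (auto simp: bilinear_map_def)
  interpret R: Vector_Spaces.linear scale scale "\<lambda>x. bracket z x"
    using bilinear_bracket by (auto simp: bilinear_map_def)
  show "bracket (x + y) z = bracket x z + bracket y z" "bracket z (x + y) = bracket z x + bracket z y"
    "bracket (scale c x) z = scale c (bracket x z)" "bracket z (scale c x) = scale c (bracket z x)"
    "bracket (x - y) z = bracket x z - bracket y z" "bracket z (x - y) = bracket z x - bracket z y"
    "bracket 0 z = 0" "bracket z 0 = 0"
    "bracket (- x) z = - bracket x z" "bracket z (- x) = - bracket z x"
    "bracket (sum f A) z = (\<Sum>a\<in>A. bracket (f a) z)"
    "bracket z (sum f A) = (\<Sum>a\<in>A. bracket z (f a))"
    by (rule L.add R.add L.scale R.scale L.diff R.diff L.zero R.zero L.neg R.neg L.sum R.sum)+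
qed

lemma bracket_skew: "bracket x y = - bracket y x"
proof -
  have "bracket x x + bracket y x + (bracket x y + bracket y y) = 0"
    using bracket_self[of "x + y"] by (simp only: bracket_linear)
  thus ?thesis by (simp add: bracket_self eq_neg_iff_add_eq_0 add.commute)
qed

lemma adjoint_lie_module: "lie_module scale bracket scale bracket"
proof unfold_locales
  fix x y v
  have "bracket (bracket x y) v = - bracket v (bracket x y)" by (rule bracket_skew)
  also have "\<dots> = bracket x (bracket y v) + bracket y (bracket v x)"
    using jacobi[of x y v] by (simp add: add_eq_0_iff2)
  also have "bracket y (bracket v x) = - bracket y (bracket x v)"
    by (subst bracket_skew[of v x]) (simp add: bracket_linear)
  finally show "bracket (bracket x y) v = bracket x (bracket y v) - bracket y (bracket x v)" by simp
qed (rule bilinear_bracket)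

text \<open>The coefficients of a linear combination of brackets can be absorbed into the brackets.\<close>

lemma perfect_sum_brackets:
  assumes perfect
  obtains m :: nat and a b where "x = (\<Sum>i<m. bracket (a i) (b i))"
proof -
  have "x \<in> span {bracket x y | x y. True}" using assms by (simp add: perfect_def derived_algebra_def)
  hence "\<exists>(m::nat) a b. x = (\<Sum>i<m. bracket (a i) (b i))"
  proof (induction rule: span_induct_alt)
    case base
    show ?case by (rule exI[of _ 0]) simp
  next
    case (step c z y)
    then obtain p q and m :: nat and a b where "z = bracket p q" "y = (\<Sum>i<m. bracket (a i) (b i))"
      by blast
    hence "scale c z + y = (\<Sum>i<Suc m. bracket ((a(m := scale c p)) i) ((b(m := q)) i))"
      by (simp add: bracket_linear)
    thus ?case by blast
  qed
  thus thesis using that by blast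
qed


end

context lie_module
begin

lemma rep_linear:
  "\<psi> (x + y) v = \<psi> x v + \<psi> y v"
  "\<psi> x (u + v) = \<psi> x u + \<psi> x v"
  "\<psi> (scale c x) v = scaleM c (\<psi> x v)"
  "\<psi> x (scaleM c v) = scaleM c (\<psi> x v)"
  "\<psi> (x - y) v = \<psi> x v - \<psi> y v"
  "\<psi> x (u - v) = \<psi> x u - \<psi> x v"
  "\<psi> 0 v = 0" "\<psi> x 0 = 0"
  "\<psi> (- x) v = - \<psi> x v"
  "\<psi> x (- v) = - \<psi> x v"
  "\<psi> (sum f A) v = (\<Sum>a\<in>A. \<psi> (f a) v)"
  "\<psi> x (sum g C) = (\<Sum>a\<in>C. \<psi> x (g a))"
proof -
  interpret L: Vector_Spaces.linear scale scaleM "\<lambda>x. \<psi> x v"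
    using bilinear_rep by (auto simp: bilinear_map_def)
  interpret R: Vector_Spaces.linear scaleM scaleM "\<lambda>v. \<psi> x v"
    using bilinear_rep by (auto simp: bilinear_map_def)
  show "\<psi> (x + y) v = \<psi> x v + \<psi> y v" "\<psi> x (u + v) = \<psi> x u + \<psi> x v"
    "\<psi> (scale c x) v = scaleM c (\<psi> x v)" "\<psi> x (scaleM c v) = scaleM c (\<psi> x v)"
    "\<psi> (x - y) v = \<psi> x v - \<psi> y v" "\<psi> x (u - v) = \<psi> x u - \<psi> x v"
    "\<psi> 0 v = 0" "\<psi> x 0 = 0" "\<psi> (- x) v = - \<psi> x v" "\<psi> x (- v) = - \<psi> x v"
    "\<psi> (sum f A) v = (\<Sum>a\<in>A. \<psi> (f a) v)" "\<psi> x (sum g C) = (\<Sum>a\<in>C. \<psi> x (g a))"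
    by (rule L.add R.add L.scale R.scale L.diff R.diff L.zero R.zero L.neg R.neg L.sum R.sum)+
qed

lemma linear_rep: "Vector_Spaces.linear scaleM scaleM (\<psi> x)"
  using bilinear_rep by (auto simp: bilinear_map_def)

end

section \<open>The trace form of a module\<close>

locale fd_lie_module = lie_module scale bracket scaleM \<psi> +
    finite_dimensional_vector_space scale basis_g + M: finite_dimensional_vector_space scaleM basis_M
  for scale :: "'k::field_char_0 \<Rightarrow> 'g::ab_group_add \<Rightarrow> 'g"
    and bracket :: "'g \<Rightarrow> 'g \<Rightarrow> 'g"
    and scaleM :: "'k \<Rightarrow> 'm::ab_group_add \<Rightarrow> 'm"
    and \<psi> :: "'g \<Rightarrow> 'm \<Rightarrow> 'm"
    and basis_g basis_M +
  assumes perfect: perfect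
begin

definition trace_form :: "'g \<Rightarrow> 'g \<Rightarrow> 'k" where
  "trace_form x y = M.trace (\<lambda>v. \<psi> x (\<psi> y v))"

lemma trace_form_sym: "trace_form x y = trace_form y x"
  unfolding trace_form_def by (rule M.trace_comp_comm[OF linear_rep linear_rep])

lemma trace_form_linear:
  "trace_form (x + y) z = trace_form x z + trace_form y z"
  "trace_form (x - y) z = trace_form x z - trace_form y z"
  "trace_form (scale c x) z = c * trace_form x z"
  "trace_form (sum f A) z = (\<Sum>a\<in>A. trace_form (f a) z)"
  "trace_form 0 z = 0" "trace_form (- x) z = - trace_form x z"
proof -
  show s: "trace_form (scale c x) z = c * trace_form x z" for x c
    unfolding trace_form_def rep_linear by (rule M.trace_linear)
  show "trace_form (x + y) z = trace_form x z + trace_form y z"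
    "trace_form (x - y) z = trace_form x z - trace_form y z"
    "trace_form (sum f A) z = (\<Sum>a\<in>A. trace_form (f a) z)"
    unfolding trace_form_def rep_linear by (rule M.trace_linear)+
  show "trace_form 0 z = 0" using s[of 0 0] by simp
  show "trace_form (- x) z = - trace_form x z" using s[of "- 1" x] by simp
qed

lemma trace_form_linear_right:
  "trace_form z (x + y) = trace_form z x + trace_form z y"
  "trace_form z (x - y) = trace_form z x - trace_form z y"
  "trace_form z (scale c x) = c * trace_form z x"
  "trace_form z (sum f A) = (\<Sum>a\<in>A. trace_form z (f a))"
  "trace_form z 0 = 0" "trace_form z (- x) = - trace_form z x"
  unfolding trace_form_sym[of z] by (rule trace_form_linear)+

lemma trace_form_invariant: "trace_form (bracket x y) z = trace_form x (bracket y z)"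
proof -
  have "M.trace (\<lambda>v. \<psi> y (\<psi> x (\<psi> z v))) = M.trace (\<lambda>v. \<psi> x (\<psi> z (\<psi> y v)))"
    using M.trace_comp_comm[OF linear_rep[of y] Vector_Spaces.linear_compose[OF linear_rep[of z] linear_rep[of x]]]
    by (simp add: o_def)
  thus ?thesis unfolding trace_form_def rep_bracket rep_linear M.trace_linear by simp
qed

lemma to_mat_bracket:
  "M.to_mat (\<psi> (bracket x y)) = mat_commutator (M.to_mat (\<psi> x)) (M.to_mat (\<psi> y))"
proof -
  have "M.to_mat (\<psi> (bracket x y)) = M.to_mat (\<lambda>v. \<psi> x (\<psi> y v) - \<psi> y (\<psi> x v))"
    by (intro arg_cong[where f = M.to_mat] ext rep_bracket)
  also have "\<dots> = M.to_mat (\<lambda>v. \<psi> x (\<psi> y v)) - M.to_mat (\<lambda>v. \<psi> y (\<psi> x v))"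
    by (rule M.to_mat_diff)
  also have "M.to_mat (\<lambda>v. \<psi> x (\<psi> y v)) = M.to_mat (\<psi> x) * M.to_mat (\<psi> y)"
    by (rule M.to_mat_comp[OF linear_rep])
  also have "M.to_mat (\<lambda>v. \<psi> y (\<psi> x v)) = M.to_mat (\<psi> y) * M.to_mat (\<psi> x)"
    by (rule M.to_mat_comp[OF linear_rep])
  finally show ?thesis by (simp only: mat_commutator_def)
qed

text \<open>Cartan's criterion for perfect Lie algebras. Write \<open>x\<close> as a sum of brackets of \<open>a i\<close> and \<open>b i\<close>.
  For \<open>r \<ge> 1\<close> the element obtained from \<open>b i\<close> by bracketing \<open>r\<close> times with \<open>x\<close> is orthogonal to \<open>a i\<close>,
  because invariance of the trace form moves one factor \<open>x\<close> to the front. So the matrices of \<open>x\<close>, \<open>a i\<close>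
  and \<open>b i\<close> satisfy the hypotheses of \<open>nilpotent_of_trace_orthogonality\<close>.\<close>

lemma nilpotent_of_trace_form_radical:
  assumes rad: "\<And>y. trace_form x y = 0"
  shows "(\<psi> x ^^ M.dimension) v = 0"
proof -
  obtain m :: nat and a b where x: "x = (\<Sum>i<m. bracket (a i) (b i))"
    using perfect_sum_brackets[OF perfect] .
  let ?n = M.dimension
  have "M.to_mat (\<psi> x) ^\<^sub>m ?n = 0\<^sub>m ?n ?n"
  proof (rule nilpotent_of_trace_orthogonality[where I = "{..<m}" and
        A = "\<lambda>i. M.to_mat (\<psi> (a i))" and B = "\<lambda>i. M.to_mat (\<psi> (b i))"])
    fix j k assume jk: "j < ?n" "k < ?n"
    have "M.to_mat (\<psi> x) $$ (j, k) = (\<Sum>i<m. M.to_mat (\<psi> (bracket (a i) (b i))) $$ (j, k))"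
      using jk by (simp add: M.to_mat_def x rep_linear M.coordinate_linear)
    thus "M.to_mat (\<psi> x) $$ (j, k)
        = (\<Sum>i<m. mat_commutator (M.to_mat (\<psi> (a i))) (M.to_mat (\<psi> (b i))) $$ (j, k))"
      by (simp only: to_mat_bracket)
  next
    fix r :: nat assume r: "r \<ge> 1"
    have pow: "(mat_commutator (M.to_mat (\<psi> x)) ^^ r) (M.to_mat (\<psi> y)) = M.to_mat (\<psi> ((bracket x ^^ r) y))"
      for y r by (induction r) (simp_all add: to_mat_bracket)
    have "trace_form y ((bracket x ^^ r) z) = 0" for y z
    proof -
      have "(bracket x ^^ r) z = bracket x ((bracket x ^^ (r - 1)) z)" using r by (cases r) auto
      hence "trace_form y ((bracket x ^^ r) z) = trace_form x (bracket ((bracket x ^^ (r - 1)) z) y)"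
        by (simp add: trace_form_sym[of y] trace_form_invariant)
      thus ?thesis using rad by simp
    qed
    hence "mat_trace (M.to_mat (\<psi> y) * M.to_mat (\<psi> ((bracket x ^^ r) z))) = 0" for y z
      unfolding M.to_mat_comp[OF linear_rep, of y "\<psi> ((bracket x ^^ r) z)", symmetric]
      by (simp only: trace_form_def M.trace_def)
    thus "(\<Sum>i<m. mat_trace (M.to_mat (\<psi> (a i)) * (mat_commutator (M.to_mat (\<psi> x)) ^^ r) (M.to_mat (\<psi> (b i))))) = 0"
      by (simp add: pow)
  qed auto
  hence "M.to_mat (\<psi> x ^^ ?n) = 0\<^sub>m ?n ?n"
    and "Vector_Spaces.linear scaleM scaleM (\<psi> x ^^ ?n)"
    using M.to_mat_funpow[OF linear_rep, of ?n x] by auto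
  thus ?thesis using M.to_mat_eq_0D by blast
qed

end

section \<open>Engel's theorem\<close>

context lie_module
begin

definition invariant :: "'g set \<Rightarrow> 'm set \<Rightarrow> bool" where
  "invariant K U \<longleftrightarrow> M.subspace U \<and> (\<forall>k\<in>K. \<forall>u\<in>U. \<psi> k u \<in> U)"

text \<open>The conclusion of Engel's theorem for \<open>K\<close>, in all quotients \<open>U / U'\<close> of invariant subspaces. The
  restriction to \<open>U' \<supseteq> N\<close> is made for the adjoint module, where the action will be known to be nilpotent
  only modulo the kernel \<open>N\<close> of \<open>\<psi>\<close>.\<close>

definition nilpotent_above :: "'m set \<Rightarrow> 'g set \<Rightarrow> bool" where
  "nilpotent_above N K \<longleftrightarrow> (\<forall>U U'. invariant K U \<longrightarrow> invariant K U' \<longrightarrow> N \<subseteq> U' \<longrightarrow> U' \<subset> U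
     \<longrightarrow> (\<exists>u\<in>U - U'. \<forall>k\<in>K. \<psi> k u \<in> U'))"

lemma nilpotent_aboveD:
  assumes "nilpotent_above N K" "invariant K U" "invariant K U'" "N \<subseteq> U'" "U' \<subset> U"
  shows "\<exists>u\<in>U - U'. \<forall>k\<in>K. \<psi> k u \<in> U'"
  using assms(1)[unfolded nilpotent_above_def, rule_format, OF assms(2-5)] .

lemma nilpotent_above_trivial:
  assumes "\<And>k v. k \<in> K \<Longrightarrow> \<psi> k v \<in> N"
  shows "nilpotent_above N K"
  unfolding nilpotent_above_def using assms by blast

text \<open>Since \<open>z\<close> normalizes \<open>K\<close>, it preserves the space of those vectors of \<open>U\<close> that \<open>K\<close> maps to \<open>U'\<close>.
  This space is larger than \<open>U'\<close>, and as \<open>z\<close> acts nilpotently, the last nonzero iterate modulo \<open>U'\<close> of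
  one of its vectors is mapped to \<open>U'\<close> by \<open>z\<close> as well.\<close>

lemma nilpotent_above_extend:
  assumes K: "subspace K" "nilpotent_above N K"
    and zK: "\<And>k. k \<in> K \<Longrightarrow> bracket k z \<in> K"
    and nil: "\<And>v. \<exists>m. (\<psi> z ^^ m) v \<in> N"
  shows "nilpotent_above N (span (insert z K))"
  unfolding nilpotent_above_def
proof (intro allI impI)
  fix U U'
  assume inv: "invariant (span (insert z K)) U" "invariant (span (insert z K)) U'"
    and N: "N \<subseteq> U'" "U' \<subset> U"
  have sub: "M.subspace U'" using inv by (simp add: invariant_def)
  have zin: "z \<in> span (insert z K)" and Kin: "\<And>k. k \<in> K \<Longrightarrow> k \<in> span (insert z K)"
    by (auto intro: span_base)
  have z_inv: "\<psi> z u \<in> U" if "u \<in> U" for u using inv(1) zin that by (simp add: invariant_def)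
  have z_inv': "\<psi> z u \<in> U'" if "u \<in> U'" for u using inv(2) zin that by (simp add: invariant_def)
  have "invariant K U" "invariant K U'" using inv Kin by (simp_all add: invariant_def)
  from nilpotent_aboveD[OF K(2) this N]
  obtain u where u: "u \<in> U - U'" "\<And>k. k \<in> K \<Longrightarrow> \<psi> k u \<in> U'" by blast
  have pow: "(\<psi> z ^^ m) u \<in> U \<and> (\<forall>k\<in>K. \<psi> k ((\<psi> z ^^ m) u) \<in> U')" for m
  proof (induction m)
    case (Suc m)
    have "\<psi> k (\<psi> z ((\<psi> z ^^ m) u)) \<in> U'" if "k \<in> K" for k
    proof -
      have "\<psi> k (\<psi> z ((\<psi> z ^^ m) u)) = \<psi> (bracket k z) ((\<psi> z ^^ m) u) + \<psi> z (\<psi> k ((\<psi> z ^^ m) u))"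
        by (simp add: rep_bracket)
      thus ?thesis using Suc zK[OF that] that z_inv' by (simp add: M.subspace_add[OF sub])
    qed
    thus ?case using Suc z_inv by simp
  qed (use u in auto)
  define m where "m = (LEAST m. (\<psi> z ^^ m) u \<in> U')"
  have ex: "\<exists>m. (\<psi> z ^^ m) u \<in> U'" using nil N by blast
  have m: "(\<psi> z ^^ m) u \<in> U'" unfolding m_def by (rule LeastI_ex[OF ex])
  then obtain l where l: "m = Suc l" using u by (cases m) auto
  have nl: "(\<psi> z ^^ l) u \<notin> U'" using not_less_Least[of l "\<lambda>m. (\<psi> z ^^ m) u \<in> U'"] l m_def by simp
  show "\<exists>u\<in>U - U'. \<forall>k\<in>span (insert z K). \<psi> k u \<in> U'"
  proof (intro bexI ballI)
    fix k assume "k \<in> span (insert z K)"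
    moreover have "span K = K" using K(1) by (simp only: span_eq_iff)
    ultimately obtain c where c: "k - scale c z \<in> K" unfolding span_breakdown_eq by auto
    have "\<psi> k ((\<psi> z ^^ l) u) = \<psi> (k - scale c z) ((\<psi> z ^^ l) u) + scaleM c (\<psi> z ((\<psi> z ^^ l) u))"
      by (simp add: rep_linear)
    moreover have "\<psi> (k - scale c z) ((\<psi> z ^^ l) u) \<in> U'" using pow c by blast
    moreover have "\<psi> z ((\<psi> z ^^ l) u) \<in> U'" using m l by simp
    ultimately show "\<psi> k ((\<psi> z ^^ l) u) \<in> U'" using sub by (simp add: M.subspace_add M.subspace_scale)
  next
    show "(\<psi> z ^^ l) u \<in> U - U'" using pow nl by blast
  qed
qed

end

context fd_lie_module
begin

definition rep_kernel :: "'g set" where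
  "rep_kernel = {x. \<forall>v. \<psi> x v = 0}"

text \<open>Bracketing \<open>y\<close> \<open>m\<close> times with \<open>x\<close> and applying \<open>\<psi>\<close> gives a combination of the operators
  \<open>\<psi>(x)\<^sup>i \<psi>(y) \<psi>(x)\<^sup>j\<close> with \<open>i + j = m\<close>; for \<open>m = 2 * n\<close> one of the exponents is at least \<open>n\<close>.\<close>

lemma rep_adjoint_funpow:
  assumes "\<And>v. (\<psi> x ^^ n) v = 0"
  shows "(bracket x ^^ (2 * n)) y \<in> rep_kernel"
proof -
  have nil: "(\<psi> x ^^ i) v = 0" if "i \<ge> n" for i v
  proof -
    have "(\<psi> x ^^ i) v = (\<psi> x ^^ (i - n)) ((\<psi> x ^^ n) v)"
      using that by (metis comp_apply funpow_add le_add_diff_inverse2)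
    also have "\<dots> = (\<psi> x ^^ (i - n)) 0" by (simp add: assms)
    also have "(\<psi> x ^^ k) 0 = 0" for k by (induction k) (simp_all add: rep_linear)
    finally show ?thesis .
  qed
  have "\<psi> ((bracket x ^^ m) y) v \<in> M.span {(\<psi> x ^^ i) (\<psi> y ((\<psi> x ^^ j) v)) | i j. i + j = m}" for m v
  proof (induction m arbitrary: v)
    case 0
    show ?case by (auto intro!: M.span_base exI[of _ 0])
  next
    case (Suc m)
    let ?S = "\<lambda>m v. {(\<psi> x ^^ i) (\<psi> y ((\<psi> x ^^ j) v)) | i j. i + j = m}"
    let ?z = "(bracket x ^^ m) y"
    have "\<psi> x (\<psi> ?z v) \<in> M.span (\<psi> x ` ?S m v)"
    proof -
      interpret R: Vector_Spaces.linear scaleM scaleM "\<psi> x" by (rule linear_rep)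
      show ?thesis using Suc.IH[of v] by (subst R.span_image) blast
    qed
    moreover have "\<psi> x ` ?S m v \<subseteq> ?S (Suc m) v"
    proof
      fix w assume "w \<in> \<psi> x ` ?S m v"
      then obtain i j where "w = \<psi> x ((\<psi> x ^^ i) (\<psi> y ((\<psi> x ^^ j) v)))" "i + j = m" by auto
      hence "w = (\<psi> x ^^ Suc i) (\<psi> y ((\<psi> x ^^ j) v)) \<and> Suc i + j = Suc m" by simp
      thus "w \<in> ?S (Suc m) v" by blast
    qed
    ultimately have 1: "\<psi> x (\<psi> ?z v) \<in> M.span (?S (Suc m) v)" using M.span_mono by blast
    have "?S m (\<psi> x v) \<subseteq> ?S (Suc m) v"
    proof
      fix w assume "w \<in> ?S m (\<psi> x v)"
      then obtain i j where "w = (\<psi> x ^^ i) (\<psi> y ((\<psi> x ^^ j) (\<psi> x v)))" "i + j = m" by auto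
      hence "w = (\<psi> x ^^ i) (\<psi> y ((\<psi> x ^^ Suc j) v)) \<and> i + Suc j = Suc m"
        by (simp add: funpow_swap1)
      thus "w \<in> ?S (Suc m) v" by blast
    qed
    hence 2: "\<psi> ?z (\<psi> x v) \<in> M.span (?S (Suc m) v)" using Suc.IH[of "\<psi> x v"] M.span_mono by blast
    show ?case using M.span_diff[OF 1 2] by (simp add: rep_bracket)
  qed
  moreover have "M.span {(\<psi> x ^^ i) (\<psi> y ((\<psi> x ^^ j) v)) | i j. i + j = 2 * n} \<subseteq> {0}" for v
  proof -
    have "(\<psi> x ^^ i) (\<psi> y ((\<psi> x ^^ j) v)) = 0" if "i + j = 2 * n" for i j
    proof (cases "i \<ge> n")
      case False
      hence "j \<ge> n" using that by simp
      hence "(\<psi> x ^^ i) (\<psi> y ((\<psi> x ^^ j) v)) = (\<psi> x ^^ i) 0" by (simp add: nil rep_linear)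
      also have "\<dots> = 0" by (induction i) (auto simp: rep_linear)
      finally show ?thesis .
    qed (rule nil)
    hence "{(\<psi> x ^^ i) (\<psi> y ((\<psi> x ^^ j) v)) | i j. i + j = 2 * n} \<subseteq> {0}" by auto
    from M.span_mono[OF this] show ?thesis by simp
  qed
  ultimately show ?thesis unfolding rep_kernel_def by blast
qed

text \<open>Among the subalgebras between the kernel of \<open>\<psi>\<close> and \<open>J\<close> for which both the adjoint module and \<open>M\<close>
  satisfy the conclusion of Engel's theorem, let \<open>K\<close> have maximal dimension. If \<open>K\<close> were not \<open>J\<close>, this
  conclusion for the adjoint module and the pair \<open>K \<subset> J\<close> would yield an element \<open>z\<close> of \<open>J\<close> outside \<open>K\<close>
  that normalizes \<open>K\<close>, and \<open>K\<close> together with \<open>z\<close> would span a larger subalgebra of this kind.\<close>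

lemma engel_common_kernel:
  assumes J: "subspace J" "\<And>x y. x \<in> J \<Longrightarrow> bracket y x \<in> J" "rep_kernel \<subseteq> J"
    and nil: "\<And>x v. x \<in> J \<Longrightarrow> (\<psi> x ^^ n) v = 0"
    and W: "invariant UNIV W" "W \<noteq> {0}"
  shows "\<exists>w\<in>W. w \<noteq> 0 \<and> (\<forall>x\<in>J. \<psi> x w = 0)"
proof -
  interpret ad: lie_module scale bracket scale bracket by (rule adjoint_lie_module)
  define good where "good = (\<lambda>K. subspace K \<and> rep_kernel \<subseteq> K \<and> K \<subseteq> J \<and>
      (\<forall>x\<in>K. \<forall>y\<in>K. bracket x y \<in> K) \<and> ad.nilpotent_above rep_kernel K \<and> nilpotent_above {0} K)"
  have ker: "bracket x y \<in> rep_kernel" if "y \<in> rep_kernel" for x y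
    using that by (simp add: rep_kernel_def rep_bracket rep_linear)
  have ker': "bracket y x \<in> rep_kernel" if "y \<in> rep_kernel" for x y
    using that by (simp add: rep_kernel_def rep_bracket rep_linear)
  have "good rep_kernel"
    unfolding good_def
  proof (intro conjI)
    show "subspace rep_kernel" by (rule subspaceI) (auto simp: rep_kernel_def rep_linear)
    show "nilpotent_above {0} rep_kernel" by (rule nilpotent_above_trivial) (simp add: rep_kernel_def)
    show "ad.nilpotent_above rep_kernel rep_kernel" by (rule ad.nilpotent_above_trivial) (rule ker')
  qed (use J ker in auto)
  moreover have "\<forall>K. good K \<longrightarrow> dim K < Suc dimension"
    using dim_subset_UNIV by (simp add: less_Suc_eq_le)
  ultimately obtain K where K: "good K" and max: "\<And>K'. good K' \<Longrightarrow> dim K' \<le> dim K"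
    using ex_has_greatest_nat[of good rep_kernel dim "Suc dimension"] by blast
  have K': "subspace K" "rep_kernel \<subseteq> K" "K \<subseteq> J" "\<And>x y. x \<in> K \<Longrightarrow> y \<in> K \<Longrightarrow> bracket x y \<in> K"
    "ad.nilpotent_above rep_kernel K" "nilpotent_above {0} K"
    using K unfolding good_def by blast+
  have "K = J"
  proof (rule ccontr)
    assume "K \<noteq> J"
    hence "K \<subset> J" using K'(3) by blast
    moreover have "ad.invariant K J" "ad.invariant K K"
      using J(1,2) K'(1,4) by (simp_all add: ad.invariant_def)
    ultimately have "\<exists>z\<in>J - K. \<forall>k\<in>K. bracket k z \<in> K"
      using K'(2,5) by (intro ad.nilpotent_aboveD[of rep_kernel]) simp_all
    then obtain z where z: "z \<in> J - K" "\<And>k. k \<in> K \<Longrightarrow> bracket k z \<in> K" by blast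
    let ?K = "span (insert z K)"
    have zin: "z \<in> ?K" and Kin: "K \<subseteq> ?K" by (auto intro: span_base)
    have decomp: "\<exists>c. \<exists>k\<in>K. x = k + scale c z" if "x \<in> ?K" for x
    proof -
      have "span K = K" using K'(1) by (simp only: span_eq_iff)
      moreover have "\<exists>c. x - scale c z \<in> span K" using that by (simp only: span_breakdown_eq)
      ultimately have "\<exists>c. x - scale c z \<in> K" by (simp only:)
      then obtain c where "x - scale c z \<in> K" by blast
      thus ?thesis by (intro exI[of _ c] bexI[of _ "x - scale c z"]) auto
    qed
    have "good ?K"
      unfolding good_def
    proof (intro conjI ballI)
      show "?K \<subseteq> J" using z(1) K'(3) J(1) by (intro span_minimal) auto
      show "rep_kernel \<subseteq> ?K" using K'(2) Kin by (rule order_trans)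
      show "nilpotent_above {0} ?K"
        using K'(1,6) z(2) nil[of z] z(1) by (intro nilpotent_above_extend) auto
      show "ad.nilpotent_above rep_kernel ?K"
        using K'(1,5) z(2) rep_adjoint_funpow[OF nil, of z] z(1) by (intro ad.nilpotent_above_extend) auto
    next
      fix x y assume "x \<in> ?K" "y \<in> ?K"
      then obtain c k c' k' where xy: "x = k + scale c z" "y = k' + scale c' z" "k \<in> K" "k' \<in> K"
        using decomp by blast
      have "bracket x y = bracket k k' + scale c' (bracket k z) - scale c (bracket k' z)"
        unfolding xy by (simp add: bracket_linear bracket_self bracket_skew[of z k'] algebra_simps)
      moreover have "\<dots> \<in> K" using xy(3,4) z(2) K'(1,4) by (simp add: subspace_add subspace_diff subspace_scale)
      ultimately show "bracket x y \<in> ?K" using Kin by auto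
    qed simp
    hence "dim ?K \<le> dim K" by (rule max)
    hence "?K = K" using K' Kin by (intro subspace_dim_equal[symmetric]) simp_all
    hence "z \<in> K" using zin by (simp only:)
    thus False using z by simp
  qed
  hence "nilpotent_above {0} J" using K'(6) by simp
  moreover have "invariant J W" "invariant J {0}"
    using W by (auto simp: invariant_def rep_linear M.subspace_def)
  moreover have "{0} \<subset> W" using W M.subspace_0[of W] by (auto simp: invariant_def)
  ultimately have "\<exists>w\<in>W - {0}. \<forall>x\<in>J. \<psi> x w \<in> {0}"
    by (intro nilpotent_aboveD[of "{0}"]) simp_all
  thus ?thesis by blast
qed

end

section \<open>The Casimir operator\<close>

context fd_lie_module
begin

lemma double_eq_0_iff: "v + v = (0::'m) \<longleftrightarrow> v = 0"
proof
  assume "v + v = 0"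
  hence "scaleM 2 v = 0" using M.scale_left_distrib[of 1 1 v] by simp
  thus "v = 0" by simp
qed simp

lemma annihilated_by_brackets:
  assumes "\<And>x y. \<psi> (bracket x y) m = 0"
  shows "\<psi> z m = 0"
proof -
  obtain n :: nat and a b where "z = (\<Sum>i<n. bracket (a i) (b i))"
    using perfect_sum_brackets[OF perfect] .
  thus ?thesis by (simp add: rep_linear assms)
qed

lemma linear_expand:
  assumes "\<And>x y. f (x + y) = f x + (f y :: 'm)" "\<And>c x. f (scale c x) = scaleM c (f x)"
    and "finite S" and "f (x - (\<Sum>t\<in>S. scale (c t) t)) = 0"
  shows "f x = (\<Sum>t\<in>S. scaleM (c t) (f t))"
proof -
  have "f (\<Sum>t\<in>S. scale (c t) t) = (\<Sum>t\<in>S. scaleM (c t) (f t))"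
    using assms(3) assms(2)[of 0 0] by (induction S rule: finite_induct) (auto simp: assms(1,2))
  thus ?thesis using assms(1)[of "x - (\<Sum>t\<in>S. scale (c t) t)" "\<Sum>t\<in>S. scale (c t) t"] assms(4) by simp
qed

text \<open>Let \<open>S\<close> be a largest set of pairwise orthogonal, non-isotropic vectors; such sets are independent.
  A vector orthogonal to \<open>S\<close> is isotropic, since otherwise it could be added to \<open>S\<close>. By polarization
  the trace form vanishes on the orthogonal complement of \<open>S\<close>, so what remains of \<open>x\<close> after subtracting
  its projection to the span of \<open>S\<close> lies in the radical.\<close>

lemma obtain_orthogonal_set:
  assumes rad: "\<And>x. (\<And>y. trace_form x y = 0) \<Longrightarrow> x \<in> rep_kernel"
  obtains S where "finite S" "\<And>s. s \<in> S \<Longrightarrow> trace_form s s \<noteq> 0"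
    "\<And>s t. s \<in> S \<Longrightarrow> t \<in> S \<Longrightarrow> s \<noteq> t \<Longrightarrow> trace_form s t = 0"
    "\<And>x. x - (\<Sum>s\<in>S. scale (trace_form x s / trace_form s s) s) \<in> rep_kernel"
proof -
  define orth where "orth = (\<lambda>S. finite S \<and> (\<forall>s\<in>S. trace_form s s \<noteq> 0) \<and>
    (\<forall>s\<in>S. \<forall>t\<in>S. s \<noteq> t \<longrightarrow> trace_form s t = 0))"
  have project: "trace_form (\<Sum>s\<in>S. scale (c s) s) t = c t * trace_form t t" if "orth S" "t \<in> S" for S c t
  proof -
    have "trace_form (\<Sum>s\<in>S. scale (c s) s) t = (\<Sum>s\<in>S. if s = t then c s * trace_form s s else 0)"
      unfolding trace_form_linear using that by (intro sum.cong refl) (auto simp: orth_def)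
    thus ?thesis using that by (simp add: orth_def)
  qed
  have "card S < Suc dimension" if S: "orth S" for S
  proof -
    have "independent S"
    proof (rule independent_if_scalars_zero)
      fix f x assume "(\<Sum>x\<in>S. scale (f x) x) = 0" "x \<in> S"
      thus "f x = 0" using project[OF S, of x f] S by (auto simp: trace_form_linear orth_def)
    qed (use S in \<open>simp add: orth_def\<close>)
    hence "card S \<le> dim (UNIV :: 'g set)" by (intro independent_card_le_dim) auto
    thus ?thesis using dim_subset_UNIV[of UNIV] by linarith
  qed
  moreover have "orth {}" by (simp add: orth_def)
  ultimately obtain S where S: "orth S" and max: "\<And>S'. orth S' \<Longrightarrow> card S' \<le> card S"
    using ex_has_greatest_nat[of orth "{}" card "Suc dimension"] by blast
  have S': "finite S" "\<And>s. s \<in> S \<Longrightarrow> trace_form s s \<noteq> 0"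
      "\<And>s t. s \<in> S \<Longrightarrow> t \<in> S \<Longrightarrow> s \<noteq> t \<Longrightarrow> trace_form s t = 0"
    using S by (auto simp: orth_def)
  have isotropic: "trace_form x x = 0" if x: "\<And>s. s \<in> S \<Longrightarrow> trace_form x s = 0" for x
  proof (rule ccontr)
    assume nz: "trace_form x x \<noteq> 0"
    have x': "trace_form s x = 0" if "s \<in> S" for s using x[OF that] trace_form_sym[of s x] by simp
    have "x \<notin> S"
    proof
      assume "x \<in> S"
      from x[OF this] nz show False by simp
    qed
    moreover have "orth (insert x S)" using S'(1,2,3) x x' nz by (simp add: orth_def)
    ultimately show False using max[of "insert x S"] S'(1) by simp
  qed
  have "x - (\<Sum>s\<in>S. scale (trace_form x s / trace_form s s) s) \<in> rep_kernel" for x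
  proof (rule rad)
    fix y
    define p where "p = (\<lambda>x. x - (\<Sum>s\<in>S. scale (trace_form x s / trace_form s s) s))"
    have p: "trace_form (p x) s = 0" if "s \<in> S" for x s
      using that S'(2)[OF that] by (simp add: p_def trace_form_linear(2) project[OF S])
    have "trace_form (p x + p y) (p x + p y) = 0"
      by (rule isotropic) (simp add: p trace_form_linear(1))
    moreover have "trace_form (p x) (p x) = 0" "trace_form (p y) (p y) = 0"
      by (rule isotropic, simp add: p)+
    ultimately have "trace_form (p x) (p y) + trace_form (p x) (p y) = 0"
      using trace_form_sym[of "p y" "p x"] by (simp add: trace_form_linear(1) trace_form_linear_right(1))
    hence "trace_form (p x) (p y) = 0" by (metis mult_2 mult_eq_0_iff zero_neq_numeral)
    moreover have "trace_form (p x) (y - p y) = 0"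
    proof -
      have "y - p y = (\<Sum>s\<in>S. scale (trace_form y s / trace_form s s) s)" by (simp add: p_def)
      thus ?thesis by (simp add: trace_form_linear_right(3,4) p)
    qed
    ultimately have "trace_form (p x) y = 0"
      by (simp add: trace_form_linear_right(2))
    thus "trace_form (x - (\<Sum>s\<in>S. scale (trace_form x s / trace_form s s) s)) y = 0"
      by (simp add: p_def)
  qed
  thus thesis using that S' by blast
qed

end

locale casimir = fd_lie_module +
  fixes S
  assumes finite_S: "finite S" and nondeg: "\<And>s. s \<in> S \<Longrightarrow> trace_form s s \<noteq> 0"
    and orth: "\<And>s t. s \<in> S \<Longrightarrow> t \<in> S \<Longrightarrow> s \<noteq> t \<Longrightarrow> trace_form s t = 0"
    and expand: "\<And>x. x - (\<Sum>s\<in>S. scale (trace_form x s / trace_form s s) s) \<in> rep_kernel"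
begin

text \<open>The set \<open>S\<close> is an orthogonal basis of the Lie algebra modulo the kernel of the representation, and
  \<open>contract \<beta>\<close> is the value of \<open>\<beta>\<close> on the canonical invariant tensor of the trace form.\<close>

definition contract :: "('b \<Rightarrow> 'b \<Rightarrow> 'c) \<Rightarrow> 'c" where
  "contract \<beta> = (\<Sum>s\<in>S. scaleM (1 / trace_form s s) (\<beta> s s))"

lemma contract_add: "contract (\<lambda>a b. f a b + g a b) = contract f + contract g"
  by (simp add: contract_def M.scale_right_distrib sum.distrib)

lemma contract_rep: "contract (\<lambda>a b. \<psi> y (f a b)) = \<psi> y (contract f)"
  by (simp add: contract_def rep_linear)

text \<open>Bracketing with \<open>y\<close> is skew-symmetric for the trace form, which is the invariance of the canonical
  tensor. Elements are expanded in \<open>S\<close> modulo the kernel only, so \<open>\<beta>\<close> has to vanish on the kernel.\<close>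

lemma contract_invariant:
  assumes add1: "\<And>x y z. \<beta> (x + y) z = \<beta> x z + \<beta> y z" and add2: "\<And>x y z. \<beta> z (x + y) = \<beta> z x + \<beta> z y"
    and scale1: "\<And>c x z. \<beta> (scale c x) z = scaleM c (\<beta> x z)"
    and scale2: "\<And>c x z. \<beta> z (scale c x) = scaleM c (\<beta> z x)"
    and ker: "\<And>x z. x \<in> rep_kernel \<Longrightarrow> \<beta> x z = 0" "\<And>x z. x \<in> rep_kernel \<Longrightarrow> \<beta> z x = 0"
  shows "contract (\<lambda>a b. \<beta> (bracket a y) b) + contract (\<lambda>a b. \<beta> a (bracket b y)) = 0"
proof -
  let ?c = "\<lambda>s t. trace_form (bracket s y) t / (trace_form s s * trace_form t t)"
  have 1: "\<beta> (bracket s y) s = (\<Sum>t\<in>S. scaleM (trace_form (bracket s y) t / trace_form t t) (\<beta> t s))" for s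
    by (rule linear_expand[of "\<lambda>x. \<beta> x s"]) (simp_all add: add1 scale1 ker expand finite_S)
  have 2: "\<beta> s (bracket s y) = (\<Sum>t\<in>S. scaleM (trace_form (bracket s y) t / trace_form t t) (\<beta> s t))" for s
    by (rule linear_expand[of "\<beta> s"]) (simp_all add: add2 scale2 ker expand finite_S)
  have 3: "contract (\<lambda>a b. \<beta> (bracket a y) b) = (\<Sum>s\<in>S. \<Sum>t\<in>S. scaleM (?c s t) (\<beta> t s))"
    by (simp add: contract_def 1 M.scale_sum_right)
  have "contract (\<lambda>a b. \<beta> a (bracket b y)) = - contract (\<lambda>a b. \<beta> (bracket a y) b)"
  proof -
    have "contract (\<lambda>a b. \<beta> a (bracket b y)) = (\<Sum>s\<in>S. \<Sum>t\<in>S. scaleM (?c t s) (\<beta> t s))"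
      by (subst sum.swap) (simp add: contract_def 2 M.scale_sum_right)
    also have "\<dots> = (\<Sum>s\<in>S. \<Sum>t\<in>S. scaleM (- ?c s t) (\<beta> t s))"
    proof (intro sum.cong refl arg_cong2[where f = scaleM])
      fix s t
      have "trace_form (bracket t y) s = trace_form t (bracket y s)" by (rule trace_form_invariant)
      also have "\<dots> = - trace_form (bracket s y) t"
        by (subst bracket_skew) (simp add: trace_form_linear_right(6) trace_form_sym[of t "bracket s y"])
      finally show "?c t s = - ?c s t" by simp
    qed
    finally show ?thesis using 3 by (simp add: sum_negf)
  qed
  thus ?thesis by simp
qed

definition casimir_op :: "'c \<Rightarrow> 'c" where
  "casimir_op v = contract (\<lambda>a b. \<psi> a (\<psi> b v))"

text \<open>Moving \<open>\<psi> y\<close> past the two factors of the Casimir operator creates the two terms that cancel by the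
  invariance of the canonical tensor.\<close>

lemma casimir_op_commute: "casimir_op (\<psi> y v) = \<psi> y (casimir_op v)"
proof -
  have "casimir_op (\<psi> y v)
    = contract (\<lambda>a b. \<psi> y (\<psi> a (\<psi> b v)) + (\<psi> (bracket a y) (\<psi> b v) + \<psi> a (\<psi> (bracket b y) v)))"
    unfolding casimir_op_def contract_def by (simp add: rep_bracket rep_linear)
  also have "\<dots> = \<psi> y (casimir_op v) + (contract (\<lambda>a b. \<psi> (bracket a y) (\<psi> b v)) + contract (\<lambda>a b. \<psi> a (\<psi> (bracket b y) v)))"
    by (simp only: contract_add contract_rep casimir_op_def)
  also have "contract (\<lambda>a b. \<psi> (bracket a y) (\<psi> b v)) + contract (\<lambda>a b. \<psi> a (\<psi> (bracket b y) v)) = 0"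
    by (rule contract_invariant) (simp_all add: rep_linear rep_kernel_def)
  finally show ?thesis by simp
qed

lemma casimir_op_linear:
  "casimir_op (u + v) = casimir_op u + casimir_op v" "casimir_op (scaleM c v) = scaleM c (casimir_op v)"
  "casimir_op 0 = 0"
  by (simp_all add: casimir_op_def contract_def rep_linear sum.distrib M.scale_right_distrib
      M.scale_sum_right mult.commute)

lemma trace_casimir_op: "M.trace casimir_op = of_nat (card S)"
proof -
  have "M.trace casimir_op = (\<Sum>s\<in>S. M.trace (\<lambda>v. scaleM (1 / trace_form s s) (\<psi> s (\<psi> s v))))"
    unfolding casimir_op_def[abs_def] contract_def by (rule M.trace_linear)
  also have "\<dots> = (\<Sum>s\<in>S. 1 / trace_form s s * trace_form s s)"
    by (simp only: M.trace_linear trace_form_def)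
  also have "\<dots> = (\<Sum>s\<in>S. 1)" using nondeg by (intro sum.cong refl) simp
  finally show ?thesis by simp
qed

end

section \<open>Symmetric biderivations with values in an irreducible module\<close>

text \<open>An irreducible module \<open>W\<close> presented inside a larger space whose other vectors carry no information:
  each acts like a vector of \<open>W\<close>. A quotient of two submodules takes this form when it is identified with
  a complement, and traces on \<open>W\<close> are then traces on the whole space.\<close>

locale irreducible_image = fd_lie_module +
  fixes W
  assumes subspace_W: "M.subspace W"
    and rep_in_W: "\<And>x v. \<psi> x v \<in> W"
    and rep_factors: "\<And>v. \<exists>w\<in>W. \<forall>x. \<psi> x v = \<psi> x w"
    and irreducible: "\<And>U. invariant UNIV U \<Longrightarrow> U \<subseteq> W \<Longrightarrow> U \<noteq> {0} \<Longrightarrow> W \<subseteq> U"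
    and nontrivial: "\<exists>x v. \<psi> x v \<noteq> 0"
begin

lemma rep_eq_0_on_W:
  assumes "\<And>w. w \<in> W \<Longrightarrow> \<psi> x w = 0"
  shows "\<psi> x v = 0"
  using rep_factors[of v] assms by fastforce

lemma W_nonzero: "W \<noteq> {0}"
  using nontrivial rep_in_W by (metis singletonD)

lemma invariant_W: "invariant UNIV W"
  using subspace_W rep_in_W by (simp add: invariant_def)

lemma subspace_W_Collect:
  assumes "P 0" "\<And>u v. P u \<Longrightarrow> P v \<Longrightarrow> P (u + v)" "\<And>c u. P u \<Longrightarrow> P (scaleM c u)"
  shows "M.subspace {w \<in> W. P w}"
  using M.subspace_0[OF subspace_W] M.subspace_add[OF subspace_W] M.subspace_scale[OF subspace_W] assms
  by (intro M.subspaceI) simp_all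

lemma fixed_eq_0:
  assumes w: "w \<in> W" "\<And>x. \<psi> x w = 0"
  shows "w = 0"
proof (rule ccontr)
  assume "w \<noteq> 0"
  let ?U = "{w \<in> W. \<forall>x. \<psi> x w = 0}"
  have "M.subspace ?U" by (rule subspace_W_Collect) (simp_all add: rep_linear)
  hence "invariant UNIV ?U" using rep_in_W M.subspace_0[OF subspace_W] by (simp add: invariant_def rep_linear)
  moreover have "?U \<noteq> {0}" using w \<open>w \<noteq> 0\<close> by blast
  ultimately have "W \<subseteq> ?U" by (intro irreducible) auto
  hence "\<psi> x w = 0" if "w \<in> W" for x w using that by blast
  hence "\<psi> x v = 0" for x v by (rule rep_eq_0_on_W)
  thus False using nontrivial by blast
qed

text \<open>The radical is an ideal that acts by nilpotent operators, so it annihilates a nonzero vector of \<open>W\<close> by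
  Engel's theorem. The vectors annihilated by an ideal form a submodule, which must be all of \<open>W\<close>.\<close>

lemma trace_form_radical_eq_kernel:
  assumes "\<And>y. trace_form x y = 0"
  shows "x \<in> rep_kernel"
proof -
  let ?J = "{x. \<forall>y. trace_form x y = 0}"
  have "\<exists>w\<in>W. w \<noteq> 0 \<and> (\<forall>x\<in>?J. \<psi> x w = 0)"
  proof (rule engel_common_kernel)
    show "subspace ?J" by (rule subspaceI) (simp_all add: trace_form_linear)
    show "bracket y x \<in> ?J" if "x \<in> ?J" for x y
    proof -
      have "trace_form (bracket y x) z = 0" for z
      proof -
        have "trace_form (bracket y x) z = - trace_form (bracket x y) z"
          by (subst bracket_skew) (rule trace_form_linear)
        also have "\<dots> = - trace_form x (bracket y z)" by (simp only: trace_form_invariant)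
        finally show ?thesis using that by simp
      qed
      thus ?thesis by simp
    qed
    show "rep_kernel \<subseteq> ?J"
    proof
      fix x assume "x \<in> rep_kernel"
      hence "trace_form x y = M.trace (\<lambda>v. 0)" for y by (simp add: trace_form_def rep_kernel_def)
      moreover have "M.trace (\<lambda>v. 0) = 0" using M.trace_linear(3)[of 0 "\<lambda>v. 0"] by simp
      ultimately show "x \<in> ?J" by simp
    qed
    show "(\<psi> x ^^ M.dimension) v = 0" if "x \<in> ?J" for x v
      using that by (intro nilpotent_of_trace_form_radical) simp
  qed (use invariant_W W_nonzero in auto)
  then obtain w where w: "w \<in> W" "w \<noteq> 0" "\<And>x. x \<in> ?J \<Longrightarrow> \<psi> x w = 0" by blast
  have J_ideal: "bracket x y \<in> ?J" if "x \<in> ?J" for x y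
    using that by (simp add: trace_form_invariant)
  let ?U = "{w \<in> W. \<forall>x\<in>?J. \<psi> x w = 0}"
  have "invariant UNIV ?U"
    unfolding invariant_def
  proof (intro conjI ballI)
    show "M.subspace ?U" by (rule subspace_W_Collect) (simp_all add: rep_linear)
    fix y u assume u: "u \<in> ?U"
    have "\<psi> x (\<psi> y u) = 0" if x: "x \<in> ?J" for x
    proof -
      have "\<psi> x (\<psi> y u) = \<psi> (bracket x y) u + \<psi> y (\<psi> x u)" by (simp add: rep_bracket)
      moreover have "\<psi> (bracket x y) u = 0" "\<psi> x u = 0" using u x J_ideal[OF x, of y] by blast+
      ultimately show ?thesis by (simp add: rep_linear)
    qed
    thus "\<psi> y u \<in> ?U" using rep_in_W by blast
  qed
  moreover have "?U \<noteq> {0}" using w by blast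
  ultimately have "W \<subseteq> ?U" by (intro irreducible) auto
  moreover have "x \<in> ?J" using assms by simp
  ultimately have "\<psi> x w = 0" if "w \<in> W" for w using that by blast
  hence "\<psi> x v = 0" for v by (rule rep_eq_0_on_W)
  thus ?thesis by (simp add: rep_kernel_def)
qed

end

locale irreducible_casimir = irreducible_image + casimir
begin

lemma casimir_op_in_W: "casimir_op v \<in> W"
  unfolding casimir_op_def contract_def
  using subspace_W rep_in_W by (intro M.subspace_sum M.subspace_scale) auto

lemma S_nonempty: "S \<noteq> {}"
proof
  assume "S = {}"
  hence "x \<in> rep_kernel" for x using expand[of x] by simp
  thus False using nontrivial by (auto simp: rep_kernel_def)
qed

text \<open>The kernel in \<open>W\<close> is a submodule because the Casimir operator commutes with the action. It is not \<open>W\<close>,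
  since the trace of the operator is the size of the nonempty set \<open>S\<close>, a nonzero number in characteristic
  zero.\<close>

lemma casimir_op_injective:
  assumes w: "w \<in> W" "casimir_op w = 0"
  shows "w = 0"
proof (rule ccontr)
  assume "w \<noteq> 0"
  let ?U = "{w \<in> W. casimir_op w = 0}"
  have "invariant UNIV ?U"
    unfolding invariant_def
  proof (intro conjI ballI)
    show "M.subspace ?U" by (rule subspace_W_Collect) (simp_all add: casimir_op_linear)
    fix y u assume "u \<in> ?U"
    hence "casimir_op (\<psi> y u) = \<psi> y 0" by (simp only: casimir_op_commute mem_Collect_eq)
    thus "\<psi> y u \<in> ?U" using rep_in_W rep_linear(8) by simp
  qed
  moreover have "?U \<noteq> {0}" using w \<open>w \<noteq> 0\<close> by blast
  ultimately have "W \<subseteq> ?U" by (intro irreducible) auto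
  hence on_W: "casimir_op v = 0" if "v \<in> W" for v using that by blast
  have "casimir_op v = 0" for v
  proof -
    obtain w where w: "w \<in> W" "\<forall>x. \<psi> x v = \<psi> x w" using rep_factors[of v] by blast
    hence "casimir_op v = casimir_op w" by (simp add: casimir_op_def contract_def)
    thus ?thesis using on_W[OF w(1)] by simp
  qed
  hence "casimir_op = (\<lambda>v. 0)" by (rule ext)
  hence "M.trace casimir_op = 0" using M.trace_linear(3)[of 0 "\<lambda>v. 0"] by simp
  thus False using trace_casimir_op S_nonempty finite_S by simp
qed

context
  fixes \<phi>
  assumes bider: "symmetric_biderivation \<phi>" and \<phi>_in_W: "\<And>x y. \<phi> x y \<in> W"
begin

lemma \<phi>_sym: "\<phi> x y = \<phi> y x"
  using bider unfolding symmetric_biderivation_def by blast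

lemma \<phi>_bracket: "\<phi> x (bracket y z) = \<psi> y (\<phi> x z) - \<psi> z (\<phi> x y)"
  "\<phi> (bracket y z) x = \<psi> y (\<phi> z x) - \<psi> z (\<phi> y x)"
  using bider unfolding symmetric_biderivation_def biderivation_def by blast+

lemma \<phi>_linear:
  "\<phi> (x + y) z = \<phi> x z + \<phi> y z" "\<phi> z (x + y) = \<phi> z x + \<phi> z y"
  "\<phi> (scale c x) z = scaleM c (\<phi> x z)" "\<phi> z (scale c x) = scaleM c (\<phi> z x)"
proof -
  have b: "bilinear_map scale scale scaleM \<phi>"
    using bider unfolding symmetric_biderivation_def biderivation_def by blast
  interpret L: Vector_Spaces.linear scale scaleM "\<lambda>x. \<phi> x z" using b by (simp add: bilinear_map_def)
  interpret R: Vector_Spaces.linear scale scaleM "\<phi> z" using b by (simp add: bilinear_map_def)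
  show "\<phi> (x + y) z = \<phi> x z + \<phi> y z" "\<phi> z (x + y) = \<phi> z x + \<phi> z y"
    "\<phi> (scale c x) z = scaleM c (\<phi> x z)" "\<phi> z (scale c x) = scaleM c (\<phi> z x)"
    by (rule L.add R.add L.scale R.scale)+
qed

text \<open>Expand \<open>\<phi> (bracket x y) (bracket u v)\<close> in the two possible orders and compare.\<close>

lemma \<phi>_exchange:
  "\<psi> (bracket x u) (\<phi> y v) - \<psi> (bracket x v) (\<phi> y u)
    - \<psi> (bracket y u) (\<phi> x v) + \<psi> (bracket y v) (\<phi> x u) = 0"
proof -
  have "\<phi> (bracket x y) (bracket u v)
      = \<psi> x (\<psi> u (\<phi> y v) - \<psi> v (\<phi> y u)) - \<psi> y (\<psi> u (\<phi> x v) - \<psi> v (\<phi> x u))"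
    by (simp only: \<phi>_bracket(2)[of x y] \<phi>_bracket(1)[of x u v] \<phi>_bracket(1)[of y u v])
  moreover have "\<phi> (bracket x y) (bracket u v)
      = \<psi> u (\<psi> x (\<phi> y v) - \<psi> y (\<phi> x v)) - \<psi> v (\<psi> x (\<phi> y u) - \<psi> y (\<phi> x u))"
    by (simp only: \<phi>_bracket(1)[of "bracket x y"] \<phi>_bracket(2)[of x y v] \<phi>_bracket(2)[of x y u])
  ultimately show ?thesis by (simp add: rep_bracket rep_linear algebra_simps)
qed

text \<open>When \<open>u\<close> acts by zero, the exchange identity says that \<open>\<psi> (bracket x v) (\<phi> y u)\<close> is symmetric in \<open>x\<close>
  and \<open>y\<close>. It is also skew-symmetric in \<open>x\<close> and \<open>v\<close>, and a function of three arguments with both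
  symmetries vanishes. Hence \<open>\<phi> y u\<close> is annihilated by all brackets, and so by the whole Lie algebra.\<close>

lemma \<phi>_kernel:
  assumes u: "u \<in> rep_kernel"
  shows "\<phi> y u = 0"
proof (rule fixed_eq_0[OF \<phi>_in_W])
  define w where "w = (\<lambda>x y v. \<psi> (bracket x v) (\<phi> y u))"
  have ker: "\<psi> (bracket a u) m = 0" for a m
    using u by (simp add: rep_kernel_def rep_bracket rep_linear)
  have sym: "w x y v = w y x v" for x y v
    using \<phi>_exchange[of x u y v] by (simp add: w_def ker)
  have skew: "w x y v = - w v y x" for x y v
    unfolding w_def by (subst bracket_skew) (simp add: rep_linear)
  have "w x y v = 0" for x y v
  proof -
    have "w x y v = w y x v" by (rule sym)
    also have "\<dots> = - w v x y" by (rule skew)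
    also have "w v x y = w x v y" by (rule sym)
    also have "\<dots> = - w y v x" by (rule skew)
    also have "w y v x = w v y x" by (rule sym)
    also have "\<dots> = - w x y v" by (rule skew)
    finally have "w x y v = - w x y v" by simp
    hence "w x y v + w x y v = 0" by (simp only: eq_neg_iff_add_eq_0)
    thus ?thesis by (simp only: double_eq_0_iff)
  qed
  hence "\<psi> (bracket a b) (\<phi> y u) = 0" for a b by (simp add: w_def)
  thus "\<psi> x (\<phi> y u) = 0" for x by (rule annihilated_by_brackets)
qed

lemma \<phi>_kernel': "u \<in> rep_kernel \<Longrightarrow> \<phi> u y = 0"
  using \<phi>_kernel[of u y] by (simp add: \<phi>_sym[of u y])

definition potential where
  "potential z = contract (\<lambda>a b. \<psi> a (\<phi> b z))"

text \<open>Whitehead's argument: up to the Casimir operator, the derivation \<open>\<lambda>y. \<phi> y z\<close> is inner, given by the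
  action on the vector \<open>potential z\<close>.\<close>

lemma casimir_op_\<phi>: "casimir_op (\<phi> y z) = \<psi> y (potential z)"
proof -
  have "casimir_op (\<phi> y z)
    = contract (\<lambda>a b. \<psi> y (\<psi> a (\<phi> b z)) + (\<psi> (bracket a y) (\<phi> b z) + \<psi> a (\<phi> (bracket b y) z)))"
    unfolding casimir_op_def contract_def by (simp add: rep_bracket \<phi>_bracket rep_linear)
  also have "\<dots> = \<psi> y (potential z) + (contract (\<lambda>a b. \<psi> (bracket a y) (\<phi> b z)) + contract (\<lambda>a b. \<psi> a (\<phi> (bracket b y) z)))"
    by (simp only: contract_add contract_rep potential_def)
  also have "contract (\<lambda>a b. \<psi> (bracket a y) (\<phi> b z)) + contract (\<lambda>a b. \<psi> a (\<phi> (bracket b y) z)) = 0"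
    by (rule contract_invariant) (simp_all add: rep_linear \<phi>_linear \<phi>_kernel' rep_kernel_def[THEN eqset_imp_iff])
  finally show ?thesis by simp
qed

lemma potential_sym: "\<psi> y (potential z) = \<psi> z (potential y)"
  unfolding casimir_op_\<phi>[symmetric] by (subst \<phi>_sym) (rule refl)

lemma potential_linear:
  "potential (x + y) = potential x + potential y" "potential (scale c x) = scaleM c (potential x)"
  by (simp_all add: potential_def contract_def rep_linear \<phi>_linear sum.distrib M.scale_right_distrib
      M.scale_sum_right mult.commute)

text \<open>The map \<open>\<lambda>a b. \<psi> a (potential b)\<close> is symmetric because \<open>\<phi>\<close> is. Its two contractions in
  \<open>contract_invariant\<close> are therefore equal, and since their sum is zero, both vanish. What remains of the
  computation that gave \<open>casimir_op_\<phi>\<close> shows that the potential itself is inner up to the Casimir operator.\<close>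

lemma casimir_op_potential: "casimir_op (potential y) = \<psi> y (contract (\<lambda>a b. \<psi> a (potential b)))"
proof -
  let ?\<beta> = "\<lambda>a b. \<psi> a (potential b)"
  have "casimir_op (potential y) = contract (\<lambda>a b. \<psi> y (\<psi> a (potential b)) + \<psi> (bracket a y) (potential b))"
    unfolding casimir_op_def contract_def
    by (simp add: rep_bracket rep_linear potential_sym[of _ y])
  also have "\<dots> = \<psi> y (contract ?\<beta>) + contract (\<lambda>a b. ?\<beta> (bracket a y) b)"
    by (simp only: contract_add contract_rep)
  also have "contract (\<lambda>a b. ?\<beta> (bracket a y) b) = 0"
  proof -
    have "contract (\<lambda>a b. ?\<beta> (bracket a y) b) + contract (\<lambda>a b. ?\<beta> a (bracket b y)) = 0"
    proof (rule contract_invariant)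
      show 1: "?\<beta> x z = 0" if "x \<in> rep_kernel" for x z using that by (simp add: rep_kernel_def)
      show "?\<beta> z x = 0" if "x \<in> rep_kernel" for x z using 1[OF that] by (simp add: potential_sym[of z x])
    qed (simp_all add: rep_linear potential_linear)
    moreover have "contract (\<lambda>a b. ?\<beta> a (bracket b y)) = contract (\<lambda>a b. ?\<beta> (bracket a y) b)"
      unfolding contract_def by (simp add: potential_sym[of _ "bracket _ y"])
    ultimately show ?thesis by (simp only: double_eq_0_iff)
  qed
  finally show ?thesis by simp
qed

text \<open>Two applications of the Casimir operator turn \<open>\<phi> y z\<close> into \<open>\<psi> y (\<psi> z m)\<close> with one and the same vector
  \<open>m\<close>. As \<open>\<phi>\<close> is symmetric, all brackets annihilate \<open>m\<close>, hence so does the perfect Lie algebra.\<close>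

lemma \<phi>_eq_0: "\<phi> y z = 0"
proof -
  define m where "m = contract (\<lambda>a b. \<psi> a (potential b))"
  have *: "casimir_op (casimir_op (\<phi> y z)) = \<psi> y (\<psi> z m)" for y z
    by (simp only: casimir_op_\<phi> casimir_op_commute casimir_op_potential m_def)
  have "\<psi> (bracket a b) m = 0" for a b
    using *[of a b] *[of b a] by (simp add: rep_bracket \<phi>_sym[of b a])
  hence "\<psi> z m = 0" by (rule annihilated_by_brackets)
  hence "casimir_op (casimir_op (\<phi> y z)) = 0" by (simp add: * rep_linear)
  thus ?thesis using casimir_op_injective casimir_op_in_W \<phi>_in_W by blast
qed

end

end

context irreducible_image
begin

lemma symmetric_biderivation_eq_0:
  assumes "symmetric_biderivation \<phi>" and "\<And>x y. \<phi> x y \<in> W"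
  shows "\<phi> x y = 0"
proof (rule obtain_orthogonal_set)
  show "x \<in> rep_kernel" if "\<And>y. trace_form x y = 0" for x
    using that by (rule trace_form_radical_eq_kernel)
next
  fix S
  assume S: "finite S" "\<And>s. s \<in> S \<Longrightarrow> trace_form s s \<noteq> 0"
    "\<And>s t. s \<in> S \<Longrightarrow> t \<in> S \<Longrightarrow> s \<noteq> t \<Longrightarrow> trace_form s t = 0"
    "\<And>x. x - (\<Sum>s\<in>S. scale (trace_form x s / trace_form s s) s) \<in> rep_kernel"
  interpret irreducible_casimir scale bracket scaleM \<psi> basis_g basis_M W S
    by unfold_locales (rule S; assumption)+
  show ?thesis using assms by (rule \<phi>_eq_0)
qed

end

section \<open>Reduction to irreducible modules\<close>

context finite_dimensional_vector_space
begin

text \<open>Extend a basis of \<open>N'\<close> to a basis of \<open>N\<close>; the map \<open>\<pi>\<close> kills the former and fixes the added vectors.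
  Its range is a complement of \<open>N'\<close> in \<open>N\<close>.\<close>

lemma obtain_relative_projection:
  assumes N: "subspace N" and N': "subspace N'" "N' \<subseteq> N"
  obtains \<pi> where "Vector_Spaces.linear scale scale \<pi>" "\<And>v. \<pi> v \<in> N" "\<And>v. \<pi> (\<pi> v) = \<pi> v"
    "\<And>v. v \<in> N' \<Longrightarrow> \<pi> v = 0" "\<And>v. v \<in> N \<Longrightarrow> \<pi> v - v \<in> N'"
proof -
  interpret P: vector_space_pair scale scale ..
  obtain B' where B': "B' \<subseteq> N'" "independent B'" "N' \<subseteq> span B'"
    using maximal_independent_subset[of N'] by metis
  have "B' \<subseteq> N" using B'(1) N'(2) by (rule order_trans)
  then obtain B where B: "B' \<subseteq> B" "B \<subseteq> N" "independent B" "N \<subseteq> span B"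
    using maximal_independent_subset_extend[of B' N] B'(2) by metis
  define f where "f = (\<lambda>b. if b \<in> B' then 0 else b)"
  obtain \<pi> where \<pi>: "Vector_Spaces.linear scale scale \<pi>" "\<And>b. b \<in> B \<Longrightarrow> \<pi> b = f b" "range \<pi> = span (f ` B)"
    using P.linear_independent_extend_subspace[OF B(3), of f] by metis
  interpret \<pi>: Vector_Spaces.linear scale scale \<pi> by (rule \<pi>(1))
  have "f ` B \<subseteq> N" using B(2) subspace_0[OF N] by (auto simp: f_def)
  hence span: "span (f ` B) \<subseteq> N" using N by (rule span_minimal)
  have in_N: "\<pi> v \<in> N" for v
  proof -
    have "\<pi> v \<in> span (f ` B)" using \<pi>(3) by (metis rangeI)
    thus ?thesis using span by (rule rev_subsetD)
  qed
  have idem: "\<pi> (\<pi> v) = \<pi> v" for v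
  proof -
    have "span (f ` B) \<subseteq> {w. \<pi> w = w}"
    proof (rule span_minimal)
      show "f ` B \<subseteq> {w. \<pi> w = w}" by (auto simp: f_def \<pi>(2) \<pi>.zero)
      show "subspace {w. \<pi> w = w}" by (rule subspaceI) (simp_all add: \<pi>.zero \<pi>.add \<pi>.scale)
    qed
    moreover have "\<pi> v \<in> span (f ` B)" using \<pi>(3) by (metis rangeI)
    ultimately show ?thesis by blast
  qed
  have zero: "\<pi> v = 0" if "v \<in> N'" for v
  proof -
    have "span B' \<subseteq> {w. \<pi> w = 0}"
    proof (rule span_minimal)
      show "B' \<subseteq> {w. \<pi> w = 0}" using B(1) by (auto simp: f_def \<pi>(2))
      show "subspace {w. \<pi> w = 0}" by (rule subspaceI) (simp_all add: \<pi>.zero \<pi>.add \<pi>.scale)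
    qed
    thus ?thesis using that B'(3) by blast
  qed
  have diff: "\<pi> v - v \<in> N'" if "v \<in> N" for v
  proof -
    have "span B \<subseteq> {w. \<pi> w - w \<in> N'}"
    proof (rule span_minimal)
      show "B \<subseteq> {w. \<pi> w - w \<in> N'}"
        using B'(1) subspace_0[OF N'(1)] subspace_neg[OF N'(1)] by (auto simp: f_def \<pi>(2))
      show "subspace {w. \<pi> w - w \<in> N'}"
      proof (rule subspaceI)
        fix x y c
        assume x: "x \<in> {w. \<pi> w - w \<in> N'}" 
        show "scale c x \<in> {w. \<pi> w - w \<in> N'}"
          using x subspace_scale[OF N'(1), of "\<pi> x - x" c] by (simp add: \<pi>.scale scale_right_diff_distrib)
        assume y: "y \<in> {w. \<pi> w - w \<in> N'}"
        show "x + y \<in> {w. \<pi> w - w \<in> N'}"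
          using x y subspace_add[OF N'(1), of "\<pi> x - x" "\<pi> y - y"] by (simp add: \<pi>.add algebra_simps)
      qed (simp add: \<pi>.zero subspace_0[OF N'(1)])
    qed
    thus ?thesis using that B(4) by blast
  qed
  show thesis using that[OF \<pi>(1) in_N idem zero diff] .
qed

end

context fd_lie_module
begin

text \<open>Let \<open>N'\<close> be a maximal proper submodule of \<open>N\<close>. On the range \<open>W\<close> of the projection \<open>\<pi>\<close> the compressed
  action \<open>\<psi>' x = \<pi> \<psi>(x) \<pi>\<close> is a copy of the irreducible module \<open>N / N'\<close>. It is a representation on
  the whole space, and \<open>\<pi> \<phi>\<close> is a symmetric biderivation for it. As \<open>\<pi> \<phi>\<close> vanishes, \<open>\<phi>\<close> has its values in
  \<open>N'\<close>.\<close>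

lemma symmetric_biderivation_descends:
  assumes bider: "symmetric_biderivation \<phi>" and N: "invariant UNIV N" "N \<noteq> {0}"
    and \<phi>_in_N: "\<And>x y. \<phi> x y \<in> N"
  obtains N' where "invariant UNIV N'" "N' \<subset> N" "\<And>x y. \<phi> x y \<in> N'"
proof -
  have sub_N: "M.subspace N" and N_inv: "\<And>x v. v \<in> N \<Longrightarrow> \<psi> x v \<in> N"
    using N(1) by (simp_all add: invariant_def)
  have "invariant UNIV {0} \<and> {0} \<subset> N"
    using N(2) M.subspace_0[OF sub_N] by (auto simp: invariant_def rep_linear)
  moreover have "\<forall>K. invariant UNIV K \<and> K \<subset> N \<longrightarrow> M.dim K < Suc M.dimension"
    using M.dim_subset_UNIV by (simp add: less_Suc_eq_le)
  ultimately obtain N' where N': "invariant UNIV N'" "N' \<subset> N"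
    and max: "\<And>K. invariant UNIV K \<Longrightarrow> K \<subset> N \<Longrightarrow> M.dim K \<le> M.dim N'"
    using ex_has_greatest_nat[of "\<lambda>K. invariant UNIV K \<and> K \<subset> N" "{0}" M.dim "Suc M.dimension"] by metis
  have sub_N': "M.subspace N'" and N'_inv: "\<And>x v. v \<in> N' \<Longrightarrow> \<psi> x v \<in> N'"
    using N'(1) by (simp_all add: invariant_def)
  obtain \<pi> where \<pi>: "Vector_Spaces.linear scaleM scaleM \<pi>" and \<pi>_in_N: "\<And>v. \<pi> v \<in> N"
    and idem: "\<And>v. \<pi> (\<pi> v) = \<pi> v" and \<pi>_0: "\<And>v. v \<in> N' \<Longrightarrow> \<pi> v = 0"
    and \<pi>_diff: "\<And>v. v \<in> N \<Longrightarrow> \<pi> v - v \<in> N'"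
    using M.obtain_relative_projection[OF sub_N sub_N' psubset_imp_subset[OF N'(2)]] by blast
  interpret \<pi>: Vector_Spaces.linear scaleM scaleM \<pi> by (rule \<pi>)
  \<comment> \<open>Modulo \<open>N'\<close>, a vector of \<open>N\<close> may be replaced by its projection before acting.\<close>
  have compress: "\<pi> (\<psi> x (\<pi> v)) = \<pi> (\<psi> x v)" if "v \<in> N" for x v
  proof -
    have "\<pi> (\<psi> x (\<pi> v)) - \<pi> (\<psi> x v) = \<pi> (\<psi> x (\<pi> v - v))" by (simp only: \<pi>.diff rep_linear)
    also have "\<dots> = 0" using that by (intro \<pi>_0 N'_inv \<pi>_diff)
    finally show ?thesis by simp
  qed
  define \<psi>' where "\<psi>' = (\<lambda>x v. \<pi> (\<psi> x (\<pi> v)))"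
  define \<phi>' where "\<phi>' = (\<lambda>x y. \<pi> (\<phi> x y))"
  define W where "W = range \<pi>"
  have \<pi>_W: "\<pi> w = w" if "w \<in> W" for w using that idem by (auto simp: W_def)
  have W_N: "w \<in> N" if "w \<in> W" for w using that \<pi>_in_N by (auto simp: W_def)
  have lin1: "Vector_Spaces.linear scale scaleM (\<lambda>x. \<psi> x v)" for v
    using bilinear_rep by (simp add: bilinear_map_def)
  have bilin': "bilinear_map scale scaleM scaleM \<psi>'"
    unfolding bilinear_map_def \<psi>'_def
  proof (intro conjI allI)
    fix x show "Vector_Spaces.linear scaleM scaleM (\<lambda>v. \<pi> (\<psi> x (\<pi> v)))"
      using Vector_Spaces.linear_compose[OF Vector_Spaces.linear_compose[OF \<pi> linear_rep[of x]] \<pi>]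
      by (simp only: o_def)
  next
    fix v show "Vector_Spaces.linear scale scaleM (\<lambda>x. \<pi> (\<psi> x (\<pi> v)))"
      using Vector_Spaces.linear_compose[OF lin1[of "\<pi> v"] \<pi>] by (simp only: o_def)
  qed
  have rep': "\<psi>' (bracket x y) v = \<psi>' x (\<psi>' y v) - \<psi>' y (\<psi>' x v)" for x y v
  proof -
    have "\<psi>' a (\<psi>' b v) = \<pi> (\<psi> a (\<psi> b (\<pi> v)))" for a b
      using compress[OF N_inv[OF \<pi>_in_N], of a b v] by (simp only: \<psi>'_def idem)
    thus ?thesis by (simp only: \<psi>'_def rep_bracket \<pi>.diff)
  qed
  interpret Q: fd_lie_module scale bracket scaleM \<psi>' basis_g basis_M
    by unfold_locales (rule bilin' rep' perfect)+
  have bider': "Q.symmetric_biderivation \<phi>'"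
    unfolding Q.symmetric_biderivation_def Q.biderivation_def
  proof (intro conjI allI)
    have bil: "bilinear_map scale scale scaleM \<phi>"
      using bider unfolding symmetric_biderivation_def biderivation_def by (elim conjE)
    show "bilinear_map scale scale scaleM \<phi>'"
      unfolding bilinear_map_def \<phi>'_def
    proof (intro conjI allI)
      fix x show "Vector_Spaces.linear scale scaleM (\<lambda>y. \<pi> (\<phi> x y))"
        using Vector_Spaces.linear_compose[OF bil[unfolded bilinear_map_def, THEN conjunct1, rule_format, of x] \<pi>]
        by (simp only: o_def)
    next
      fix y show "Vector_Spaces.linear scale scaleM (\<lambda>x. \<pi> (\<phi> x y))"
        using Vector_Spaces.linear_compose[OF bil[unfolded bilinear_map_def, THEN conjunct2, rule_format, of y] \<pi>]
        by (simp only: o_def)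
    qed
    fix x y z
    have red: "\<psi>' a (\<phi>' b c) = \<pi> (\<psi> a (\<phi> b c))" for a b c
      using compress[OF \<phi>_in_N, of a b c] by (simp only: \<psi>'_def \<phi>'_def idem)
    show "\<phi>' x (bracket y z) = \<psi>' y (\<phi>' x z) - \<psi>' z (\<phi>' x y)"
      unfolding red unfolding \<phi>'_def \<pi>.diff[symmetric]
      using bider by (simp add: symmetric_biderivation_def biderivation_def)
    show "\<phi>' (bracket y z) x = \<psi>' y (\<phi>' z x) - \<psi>' z (\<phi>' y x)"
      unfolding red unfolding \<phi>'_def \<pi>.diff[symmetric]
      using bider by (simp add: symmetric_biderivation_def biderivation_def)
    show "\<phi>' x y = \<phi>' y x"
      unfolding \<phi>'_def using bider by (simp add: symmetric_biderivation_def)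
  qed
  have "\<phi>' x y = 0" for x y
  proof (cases "\<exists>x v. \<psi>' x v \<noteq> 0")
    case True
    interpret Q: irreducible_image scale bracket scaleM \<psi>' basis_g basis_M W
    proof unfold_locales
      show "M.subspace W" unfolding W_def by (rule \<pi>.subspace_image[OF M.subspace_UNIV])
      show "\<psi>' x v \<in> W" for x v by (simp add: \<psi>'_def W_def)
      show "\<exists>w\<in>W. \<forall>x. \<psi>' x v = \<psi>' x w" for v
        by (rule bexI[of _ "\<pi> v"]) (simp_all add: \<psi>'_def W_def idem)
      show "\<exists>x v. \<psi>' x v \<noteq> 0" by (rule True)
      fix U assume U: "Q.invariant UNIV U" "U \<subseteq> W" "U \<noteq> {0}"
      have sub_U: "M.subspace U" and U_inv: "\<And>x v. v \<in> U \<Longrightarrow> \<psi>' x v \<in> U"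
        using U(1) by (simp_all add: Q.invariant_def)
      \<comment> \<open>The submodule of \<open>N\<close> above \<open>N'\<close> that corresponds to \<open>U\<close>.\<close>
      let ?P = "{v \<in> N. \<pi> v \<in> U}"
      have sub_P: "M.subspace ?P"
        by (rule M.subspaceI)
          (simp_all add: \<pi>.zero \<pi>.add \<pi>.scale M.subspace_0[OF sub_N] M.subspace_0[OF sub_U]
            M.subspace_add[OF sub_N] M.subspace_add[OF sub_U] M.subspace_scale[OF sub_N] M.subspace_scale[OF sub_U])
      have "\<psi> x v \<in> ?P" if "v \<in> ?P" for x v
      proof -
        have v: "v \<in> N" "\<pi> v \<in> U" using that by simp_all
        have "\<psi>' x (\<pi> v) = \<pi> (\<psi> x v)" by (simp only: \<psi>'_def idem compress[OF v(1)])
        thus ?thesis using U_inv[OF v(2), of x] N_inv[OF v(1), of x] by simp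
      qed
      hence inv_P: "invariant UNIV ?P" using sub_P unfolding invariant_def by blast
      have N'_P: "N' \<subseteq> ?P"
      proof
        fix v assume "v \<in> N'"
        thus "v \<in> ?P" using N'(2) \<pi>_0[of v] M.subspace_0[OF sub_U] by auto
      qed
      have "?P = N"
      proof (rule ccontr)
        assume "?P \<noteq> N"
        hence "?P \<subset> N" by blast
        with inv_P have "M.dim ?P \<le> M.dim N'" by (rule max)
        with sub_N' sub_P N'_P have P_eq: "N' = ?P" by (intro M.subspace_dim_equal)
        have "u = 0" if "u \<in> U" for u
        proof -
          have u: "u \<in> W" using U(2) that by (rule subsetD)
          have "u \<in> ?P" using W_N[OF u] \<pi>_W[OF u] that by simp
          hence "u \<in> N'" by (simp only: P_eq[symmetric])
          thus ?thesis using \<pi>_0[of u] \<pi>_W[OF u] by simp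
        qed
        thus False using U(3) M.subspace_0[OF sub_U] by blast
      qed
      show "W \<subseteq> U"
      proof
        fix w assume w: "w \<in> W"
        have "w \<in> ?P" unfolding \<open>?P = N\<close> by (rule W_N[OF w])
        thus "w \<in> U" using \<pi>_W[OF w] by simp
      qed
    qed
    show ?thesis
      by (rule Q.symmetric_biderivation_eq_0[OF bider']) (simp add: \<phi>'_def W_def)
  next
    \<comment> \<open>In a trivial module a biderivation vanishes on brackets, which span a perfect Lie algebra.\<close>
    case False
    obtain m :: nat and a b where y: "y = (\<Sum>i<m. bracket (a i) (b i))"
      using perfect_sum_brackets[OF perfect] .
    have 0: "\<phi>' x (bracket a b) = 0" for a b
      using False bider' by (simp add: Q.symmetric_biderivation_def Q.biderivation_def)
    interpret R: Vector_Spaces.linear scale scaleM "\<phi>' x"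
      using bider' by (simp add: Q.symmetric_biderivation_def Q.biderivation_def bilinear_map_def)
    show ?thesis by (simp add: y R.sum 0)
  qed
  hence "\<phi> x y \<in> N'" for x y
    using \<pi>_diff[OF \<phi>_in_N, of x y] M.subspace_neg[OF sub_N', of "- \<phi> x y"] by (simp add: \<phi>'_def)
  thus thesis using that N' by blast
qed

lemma symmetric_biderivation_trivial:
  assumes bider: "symmetric_biderivation \<phi>"
  shows "\<phi> x y = 0"
proof -
  have "\<phi> x y = 0" if "invariant UNIV N" "\<And>x y. \<phi> x y \<in> N" for N
    using that
  proof (induction "M.dim N" arbitrary: N rule: less_induct)
    case less
    show ?case
    proof (cases "N = {0}")
      case True
      thus ?thesis using less.prems(2)[of x y] by simp
    next
      case False
      obtain N' where N': "invariant UNIV N'" "N' \<subset> N" "\<And>x y. \<phi> x y \<in> N'"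
        using symmetric_biderivation_descends[OF bider less.prems(1) False less.prems(2)] by blast
      have "M.span N' \<subset> M.span N"
        using N' less.prems(1) by (simp add: invariant_def M.span_eq_iff[THEN iffD2])
      hence "M.dim N' < M.dim N" by (rule M.dim_psubset)
      thus ?thesis using N'(1,3) by (rule less.hyps)
    qed
  qed
  from this[of UNIV] show ?thesis by (simp add: invariant_def)
qed

end

theorem theorem5p2:
  fixes scale :: "'k::field_char_0 \<Rightarrow> 'g::ab_group_add \<Rightarrow> 'g"
    and bracket :: "'g \<Rightarrow> 'g \<Rightarrow> 'g"
    and scaleM :: "'k \<Rightarrow> 'm::ab_group_add \<Rightarrow> 'm"
    and \<psi> :: "'g \<Rightarrow> 'm \<Rightarrow> 'm"
    and \<phi> :: "'g \<Rightarrow> 'g \<Rightarrow> 'm"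
  assumes "lie_module scale bracket scaleM \<psi>"
    and "finite_dimensional scale"
    and "lie_algebra.perfect scale bracket"
    and "finite_dimensional scaleM"
    and "lie_module.symmetric_biderivation scale bracket scaleM \<psi> \<phi>"
  shows "\<forall>x y. \<phi> x y = 0"
proof -
  obtain basis_g where g: "finite_dimensional_vector_space scale basis_g"
    using assms(2) by (auto simp: finite_dimensional_def)
  obtain basis_M where M: "finite_dimensional_vector_space scaleM basis_M"
    using assms(4) by (auto simp: finite_dimensional_def)
  interpret lie_module scale bracket scaleM \<psi> by (rule assms(1))
  interpret finite_dimensional_vector_space scale basis_g by (rule g)
  interpret M: finite_dimensional_vector_space scaleM basis_M by (rule M)
  interpret fd_lie_module scale bracket scaleM \<psi> basis_g basis_M
    by unfold_locales (rule assms(3))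
  show ?thesis using symmetric_biderivation_trivial[OF assms(5)] by blast
qed

end
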